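(* Let $\mathcal C_1,\mathcal C_2$ be symmetric monoidal closed categories, let $f^*:\mathcal C_1\to\mathcal C_2$ be a symmetric monoidal functor, and let $K$ be an object of $\mathcal C_1$. Then the natural morphism $$\beta_K: f^*D_K^o\to D_{f^*K}^o(f^* )^o,\qquad \beta_{A,K}:f^*[A,K]\to[f^*A,f^*K],$$ defines a duality preserving functor $\{f^*,\beta_K\}$ from $(\mathcal C_1)_K=(\mathcal C_1,D_K,\varpi_K)$ to $(\mathcal C_2)_{f^*K}=(\mathcal C_2,D_{f^*K},\varpi_{f^*K})$. If $\mathcal C_1,\mathcal C_2,f^*$ are suspended (resp. triangulated, with $f^*$ exact), then $\{f^*,\beta_K\}$ is a duality preserving functor of suspended (resp. triangulated) categories with duality.
   Context: Closed categories. A symmetric monoidal closed category $(\mathcal C,\otimes)$ (with symmetry $s$) has an internal Hom $[-,-]$ with adjunctions $(-\otimes X)\dashv[X,-]$ natural in $X$, with counit $\mathrm{ev}^l_{X,A}:[X,A]\otimes X\to A$ and unit $\mathrm{coev}^l_{X,A}:A\to[X,A\otimes X]$. Put $\mathrm{ev}^r_{A,K}=\mathrm{ev}^l_{A,K}\circ s:A\otimes[A,K]\to K$. Dualities. For an object $K$, $D_K=[-,K]:\mathcal C\to\mathcal C^o$, with opposite functor $D_K^o:\mathcal C^o\to\mathcal C$, and $\varpi_K:\mathrm{Id}\to D_K^oD_K$ is the natural transformation whose component $\varpi_{K,A}:A\to[[A,K],K]$ corresponds to $\mathrm{ev}^r_{A,K}$ under $(-\otimes[A,K])\dashv[[A,K],-]$.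 Write $\mathcal C_K=(\mathcal C,D_K,\varpi_K)$; this is a category with duality, i.e. $D_K$ is left adjoint to $D_K^o$ with unit $\varpi_K$ and counit $\varpi_K^o$. A duality preserving functor $\{F,\phi\}:(\mathcal C_1,D_1,\varpi_1)\to(\mathcal C_2,D_2,\varpi_2)$ is a functor $F:\mathcal C_1\to\mathcal C_2$ and a natural transformation $\phi:FD_1^o\to D_2^oF^o$ (components $\phi_A:FD_1A\to D_2FA$) such that $\phi_{D_1A}\circ F(\varpi_{1,A})=D_2(\phi_A)\circ\varpi_{2,FA}$ for all $A$. Monoidal functors. A symmetric monoidal functor $f^*$ comes with a natural isomorphism $\alpha_{A,B}:f^*A\otimes f^*B\to f^*(A\otimes B)$ (and, when units are considered, $f^*\mathbf 1\simeq\mathbf 1$) compatible with associativity, symmetry (and units). The morphism $\beta_{A,B}:f^*[A,B]\to[f^*A,f^*B]$ is the composition $f^*[A,B]\xrightarrow{\mathrm{coev}^l}[f^*A,f^*[A,B]\otimes f^*A]\xrightarrow{\alpha}[f^*A,f^*([A,B]\otimes A)]\xrightarrow{\mathrm{ev}^l}[f^*A,f^*B]$. Suspended and triangulated versions. A suspended category is an additive category with a functor $T$ having a strict inverse $T^{-1}$; $\mathcal C^o$ is suspended by $(T^{-1})^o$. A suspended functor is a functor $F$ with an isomorphism $FT\to TF$; morphisms of suspended functors are natural transformations commuting with these isomorphisms. A suspended bifunctor is a bifunctor $B$ with natural isomorphisms $b_1:B(TA,C)\to TB(A,C)$, $b_2:B(A,TC)\to TB(A,C)$ such that $T(b_{1,A,C})\circ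 b_{2,TA,C}=-T(b_{2,A,C})\circ b_{1,A,TC}$; morphisms of suspended bifunctors are natural transformations commuting with the $b_1$'s and $b_2$'s. A symmetric monoidal closed category is suspended if $\mathcal C$ is suspended and $\otimes$ is a suspended bifunctor, with structure $tp_1:TA\otimes B\to T(A\otimes B)$, $tp_2:A\otimes TB\to T(A\otimes B)$, such that for each of the three variables the ways of moving $T$ out of a triple tensor product commute with associativity, and $T(s)\circ tp_1=tp_2\circ s$. Then $[-,-]$ is a suspended bifunctor via the unique $th_1:[T^{-1}A,K]\to T[A,K]$ and $th_2:[A,TK]\to T[A,K]$ with $T(\mathrm{ev}^l_{A,K})\circ tp_1\circ(th_2\otimes \mathrm{id})=\mathrm{ev}^l_{A,TK}$ and $\mathrm{ev}^l_{TA,K}\circ(T^{-1}th_{1,TA,K}\otimes\mathrm{id})=\mathrm{ev}^l_{A,K}\circ tp_1^{-1}\circ tp_2$ on $T^{-1}[A,K]\otimes TA$; $D_K$ and $D_K^o$ are suspended via $th_1$. It is triangulated if $\mathcal C$ is triangulated with suspension $T$, $\otimes$ is exact in both variables and $[-,-]$ is exact in the first variable; a suspended functor $(F,\varphi)$ is exact if it sends an exact triangle $(u,v,w)$ to the exact triangle $(Fu,Fv,\varphi\circ Fw)$ (contravariant case: $A\xrightarrow{u}B\xrightarrow{v}C\xrightarrow{w}TA$ is sent to $(Fv,Fu,\varphi_C\circ FT^{-1}w)$). A suspended (resp. triangulated) symmetric monoidal functor is a suspended (resp. exact) functor for which $\alpha$ is a morphism of suspended bifunctors. A duality preserving functor $\{F,\phi\}$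 of suspended (resp. triangulated) categories with duality is one with $F$ suspended (resp. exact) and $\phi$ a morphism of suspended functors. *)

theory Defs
  imports "HOL-Algebra.Group"
begin

section \<open>Categories, functors, natural transformations, adjunctions\<close>

record ('o, 'a) cat =
  Obj :: "'o set"
  Arr :: "'a set"
  Dom :: "'a \<Rightarrow> 'o"
  Cod :: "'a \<Rightarrow> 'o"
  Ident :: "'o \<Rightarrow> 'a"
  Comp :: "'a \<Rightarrow> 'a \<Rightarrow> 'a"  (infixr "\<cdot>\<index>" 75)

definition Hom :: "('o, 'a) cat \<Rightarrow> 'o \<Rightarrow> 'o \<Rightarrow> 'a set" where
  "Hom C A B = {f \<in> Arr C. Dom C f = A \<and> Cod C f = B}"

locale category =
  fixes C :: "('o, 'a) cat"
  assumes Dom_Obj: "f \<in> Arr C \<Longrightarrow> Dom C f \<in> Obj C"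
    and Cod_Obj: "f \<in> Arr C \<Longrightarrow> Cod C f \<in> Obj C"
    and Ident_Hom: "A \<in> Obj C \<Longrightarrow> Ident C A \<in> Hom C A A"
    and Comp_Hom: "f \<in> Hom C A B \<Longrightarrow> g \<in> Hom C B E \<Longrightarrow> g \<cdot>\<^bsub>C\<^esub> f \<in> Hom C A E"
    and Comp_Ident: "f \<in> Hom C A B \<Longrightarrow> f \<cdot>\<^bsub>C\<^esub> Ident C A = f"
    and Ident_Comp: "f \<in> Hom C A B \<Longrightarrow> Ident C B \<cdot>\<^bsub>C\<^esub> f = f"
    and Comp_assoc: "f \<in> Hom C A B \<Longrightarrow> g \<in> Hom C B E \<Longrightarrow> h \<in> Hom C E G \<Longrightarrow>
      (h \<cdot>\<^bsub>C\<^esub> g) \<cdot>\<^bsub>C\<^esub> f = h \<cdot>\<^bsub>C\<^esub> (g \<cdot>\<^bsub>C\<^esub> f)"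

definition op_cat :: "('o, 'a) cat \<Rightarrow> ('o, 'a) cat" where
  "op_cat C = \<lparr>Obj = Obj C, Arr = Arr C, Dom = Cod C, Cod = Dom C, Ident = Ident C,
     Comp = (\<lambda>g f. f \<cdot>\<^bsub>C\<^esub> g)\<rparr>"

definition prod_cat :: "('o, 'a) cat \<Rightarrow> ('p, 'b) cat \<Rightarrow> ('o \<times> 'p, 'a \<times> 'b) cat" where
  "prod_cat C D = \<lparr>Obj = Obj C \<times> Obj D, Arr = Arr C \<times> Arr D,
     Dom = map_prod (Dom C) (Dom D), Cod = map_prod (Cod C) (Cod D),
     Ident = map_prod (Ident C) (Ident D),
     Comp = (\<lambda>(g, g') (f, f'). (g \<cdot>\<^bsub>C\<^esub> f, g' \<cdot>\<^bsub>D\<^esub> f'))\<rparr>"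

definition inverse_arrows :: "('o, 'a) cat \<Rightarrow> 'a \<Rightarrow> 'a \<Rightarrow> bool" where
  "inverse_arrows C f g \<longleftrightarrow> f \<in> Arr C \<and> g \<in> Hom C (Cod C f) (Dom C f) \<and>
     g \<cdot>\<^bsub>C\<^esub> f = Ident C (Dom C f) \<and> f \<cdot>\<^bsub>C\<^esub> g = Ident C (Cod C f)"

definition iso_arrow :: "('o, 'a) cat \<Rightarrow> 'a \<Rightarrow> bool" where
  "iso_arrow C f \<longleftrightarrow> (\<exists>g. inverse_arrows C f g)"

definition inv_arrow :: "('o, 'a) cat \<Rightarrow> 'a \<Rightarrow> 'a" where
  "inv_arrow C f = (THE g. inverse_arrows C f g)"

text \<open>A functor and its opposite have the same action on objects and arrows, so the record of a
  functor \<open>F : C \<rightarrow> D\<close> is also the record of \<open>F\<^sup>o : op_cat C \<rightarrow> op_cat D\<close>; likewise an arrow of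
  \<open>C\<close> is its own opposite.\<close>

record ('o, 'a, 'p, 'b) cfunctor =
  fob :: "'o \<Rightarrow> 'p"
  far :: "'a \<Rightarrow> 'b"

locale is_functor =
  source: category C + target: category D
  for C :: "('o, 'a) cat" and D :: "('p, 'b) cat" +
  fixes F :: "('o, 'a, 'p, 'b) cfunctor"
  assumes fob_Obj: "A \<in> Obj C \<Longrightarrow> fob F A \<in> Obj D"
    and far_Hom: "f \<in> Hom C A B \<Longrightarrow> far F f \<in> Hom D (fob F A) (fob F B)"
    and far_Ident: "A \<in> Obj C \<Longrightarrow> far F (Ident C A) = Ident D (fob F A)"
    and far_Comp: "f \<in> Hom C A B \<Longrightarrow> g \<in> Hom C B E \<Longrightarrow>
      far F (g \<cdot>\<^bsub>C\<^esub> f) = far F g \<cdot>\<^bsub>D\<^esub> far F f"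

definition id_functor :: "('o, 'a, 'o, 'a) cfunctor" where
  "id_functor = \<lparr>fob = (\<lambda>A. A), far = (\<lambda>f. f)\<rparr>"

definition comp_functor ::
  "('p, 'b, 'q, 'c) cfunctor \<Rightarrow> ('o, 'a, 'p, 'b) cfunctor \<Rightarrow> ('o, 'a, 'q, 'c) cfunctor"
  (infixr "\<circ>\<^sub>F" 75) where
  "G \<circ>\<^sub>F F = \<lparr>fob = (\<lambda>A. fob G (fob F A)), far = (\<lambda>f. far G (far F f))\<rparr>"

definition prod_functor ::
  "('o, 'a, 'p, 'b) cfunctor \<Rightarrow> ('q, 'c, 'r, 'd) cfunctor \<Rightarrow>
   ('o \<times> 'q, 'a \<times> 'c, 'p \<times> 'r, 'b \<times> 'd) cfunctor" (infixr "\<times>\<^sub>F" 80) where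
  "F \<times>\<^sub>F G = \<lparr>fob = map_prod (fob F) (fob G), far = map_prod (far F) (far G)\<rparr>"

text \<open>The partial functors \<open>B(A, -)\<close> and \<open>B(-, A)\<close> of a bifunctor; the category argument is the one
  in which the fixed object \<open>A\<close> lives (it and its opposite have the same identities).\<close>

definition fix_fst ::
  "('o, 'a) cat \<Rightarrow> ('o \<times> 'p, 'a \<times> 'b, 'q, 'c) cfunctor \<Rightarrow> 'o \<Rightarrow> ('p, 'b, 'q, 'c) cfunctor" where
  "fix_fst C B A = \<lparr>fob = (\<lambda>X. fob B (A, X)), far = (\<lambda>f. far B (Ident C A, f))\<rparr>"

definition fix_snd ::
  "('p, 'b) cat \<Rightarrow> ('o \<times> 'p, 'a \<times> 'b, 'q, 'c) cfunctor \<Rightarrow> 'p \<Rightarrow> ('o, 'a, 'q, 'c) cfunctor" where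
  "fix_snd D B A = \<lparr>fob = (\<lambda>X. fob B (X, A)), far = (\<lambda>f. far B (f, Ident D A))\<rparr>"

locale natural_transformation =
  F: is_functor C D F + G: is_functor C D G
  for C :: "('o, 'a) cat" and D :: "('p, 'b) cat"
    and F :: "('o, 'a, 'p, 'b) cfunctor" and G :: "('o, 'a, 'p, 'b) cfunctor" +
  fixes \<eta> :: "'o \<Rightarrow> 'b"
  assumes component_Hom: "A \<in> Obj C \<Longrightarrow> \<eta> A \<in> Hom D (fob F A) (fob G A)"
    and natural: "f \<in> Hom C A B \<Longrightarrow> far G f \<cdot>\<^bsub>D\<^esub> \<eta> A = \<eta> B \<cdot>\<^bsub>D\<^esub> far F f"

locale natural_isomorphism =
  natural_transformation C D F G \<eta>
  for C :: "('o, 'a) cat" and D :: "('p, 'b) cat"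
    and F :: "('o, 'a, 'p, 'b) cfunctor" and G :: "('o, 'a, 'p, 'b) cfunctor"
    and \<eta> :: "'o \<Rightarrow> 'b" +
  assumes component_iso: "A \<in> Obj C \<Longrightarrow> iso_arrow D (\<eta> A)"

locale adjunction =
  unit: natural_transformation C C id_functor "G \<circ>\<^sub>F F" \<eta> +
  counit: natural_transformation D D "F \<circ>\<^sub>F G" id_functor \<epsilon> +
  left: is_functor C D F +
  right: is_functor D C G
  for C :: "('o, 'a) cat" and D :: "('p, 'b) cat"
    and F :: "('o, 'a, 'p, 'b) cfunctor" and G :: "('p, 'b, 'o, 'a) cfunctor"
    and \<eta> :: "'o \<Rightarrow> 'a" and \<epsilon> :: "'p \<Rightarrow> 'b" +
  assumes triangle_left: "A \<in> Obj C \<Longrightarrow>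
      \<epsilon> (fob F A) \<cdot>\<^bsub>D\<^esub> far F (\<eta> A) = Ident D (fob F A)"
    and triangle_right: "B \<in> Obj D \<Longrightarrow>
      far G (\<epsilon> B) \<cdot>\<^bsub>C\<^esub> \<eta> (fob G B) = Ident C (fob G B)"


section \<open>Symmetric monoidal closed categories\<close>

text \<open>The unit is optional: \<open>munit M = None\<close> means that units are not considered.\<close>

record ('o, 'a) monoidal_unit =
  unit_ob :: 'o
  lunitor :: "'o \<Rightarrow> 'a"
  runitor :: "'o \<Rightarrow> 'a"

record ('o, 'a) monoidal_closed =
  tensor :: "('o \<times> 'o, 'a \<times> 'a, 'o, 'a) cfunctor"
  assoc :: "'o \<Rightarrow> 'o \<Rightarrow> 'o \<Rightarrow> 'a"
  symm :: "'o \<Rightarrow> 'o \<Rightarrow> 'a"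
  munit :: "('o, 'a) monoidal_unit option"
  ihom :: "('o \<times> 'o, 'a \<times> 'a, 'o, 'a) cfunctor"
  ev :: "'o \<Rightarrow> 'o \<Rightarrow> 'a"
  coev :: "'o \<Rightarrow> 'o \<Rightarrow> 'a"

abbreviation tensor_ob :: "('o, 'a) monoidal_closed \<Rightarrow> 'o \<Rightarrow> 'o \<Rightarrow> 'o" (infixl "\<boxtimes>\<index>" 80) where
  "A \<boxtimes>\<^bsub>M\<^esub> B \<equiv> fob (tensor M) (A, B)"

abbreviation tensor_ar :: "('o, 'a) monoidal_closed \<Rightarrow> 'a \<Rightarrow> 'a \<Rightarrow> 'a" (infixl "\<star>\<index>" 80) where
  "f \<star>\<^bsub>M\<^esub> g \<equiv> far (tensor M) (f, g)"

abbreviation ihom_ob :: "('o, 'a) monoidal_closed \<Rightarrow> 'o \<Rightarrow> 'o \<Rightarrow> 'o" where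
  "ihom_ob M A B \<equiv> fob (ihom M) (A, B)"

abbreviation ihom_ar :: "('o, 'a) monoidal_closed \<Rightarrow> 'a \<Rightarrow> 'a \<Rightarrow> 'a" where
  "ihom_ar M f g \<equiv> far (ihom M) (f, g)"

locale symmetric_monoidal_category =
  category C + tensor: is_functor "prod_cat C C" C "tensor M"
  for C :: "('o, 'a) cat" and M :: "('o, 'a) monoidal_closed" +
  assumes symm_iso: "natural_isomorphism (prod_cat C C) C (tensor M)
        (tensor M \<circ>\<^sub>F \<lparr>fob = prod.swap, far = prod.swap\<rparr>) (\<lambda>(A, B). symm M A B)"
    and symm_symm: "A \<in> Obj C \<Longrightarrow> B \<in> Obj C \<Longrightarrow>
      symm M B A \<cdot>\<^bsub>C\<^esub> symm M A B = Ident C (A \<boxtimes>\<^bsub>M\<^esub> B)"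
    and assoc_Hom: "A \<in> Obj C \<Longrightarrow> B \<in> Obj C \<Longrightarrow> E \<in> Obj C \<Longrightarrow>
      assoc M A B E \<in> Hom C ((A \<boxtimes>\<^bsub>M\<^esub> B) \<boxtimes>\<^bsub>M\<^esub> E) (A \<boxtimes>\<^bsub>M\<^esub> (B \<boxtimes>\<^bsub>M\<^esub> E))"
    and assoc_iso: "A \<in> Obj C \<Longrightarrow> B \<in> Obj C \<Longrightarrow> E \<in> Obj C \<Longrightarrow> iso_arrow C (assoc M A B E)"
    and assoc_natural: "f \<in> Hom C A A' \<Longrightarrow> g \<in> Hom C B B' \<Longrightarrow> h \<in> Hom C E E' \<Longrightarrow>
      (f \<star>\<^bsub>M\<^esub> (g \<star>\<^bsub>M\<^esub> h)) \<cdot>\<^bsub>C\<^esub> assoc M A B E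
        = assoc M A' B' E' \<cdot>\<^bsub>C\<^esub> ((f \<star>\<^bsub>M\<^esub> g) \<star>\<^bsub>M\<^esub> h)"
    and pentagon: "A \<in> Obj C \<Longrightarrow> B \<in> Obj C \<Longrightarrow> E \<in> Obj C \<Longrightarrow> G \<in> Obj C \<Longrightarrow>
      assoc M A B (E \<boxtimes>\<^bsub>M\<^esub> G) \<cdot>\<^bsub>C\<^esub> assoc M (A \<boxtimes>\<^bsub>M\<^esub> B) E G
        = (Ident C A \<star>\<^bsub>M\<^esub> assoc M B E G) \<cdot>\<^bsub>C\<^esub> assoc M A (B \<boxtimes>\<^bsub>M\<^esub> E) G
            \<cdot>\<^bsub>C\<^esub> (assoc M A B E \<star>\<^bsub>M\<^esub> Ident C G)"
    and hexagon: "A \<in> Obj C \<Longrightarrow> B \<in> Obj C \<Longrightarrow> E \<in> Obj C \<Longrightarrow>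
      assoc M B E A \<cdot>\<^bsub>C\<^esub> symm M A (B \<boxtimes>\<^bsub>M\<^esub> E) \<cdot>\<^bsub>C\<^esub> assoc M A B E
        = (Ident C B \<star>\<^bsub>M\<^esub> symm M A E) \<cdot>\<^bsub>C\<^esub> assoc M B A E
            \<cdot>\<^bsub>C\<^esub> (symm M A B \<star>\<^bsub>M\<^esub> Ident C E)"
    and unit_Obj: "munit M = Some U \<Longrightarrow> unit_ob U \<in> Obj C"
    and lunitor_iso: "munit M = Some U \<Longrightarrow>
      natural_isomorphism C C (fix_fst C (tensor M) (unit_ob U)) id_functor (lunitor U)"
    and runitor_iso: "munit M = Some U \<Longrightarrow>
      natural_isomorphism C C (fix_snd C (tensor M) (unit_ob U)) id_functor (runitor U)"
    and unit_triangle: "munit M = Some U \<Longrightarrow> A \<in> Obj C \<Longrightarrow> B \<in> Obj C \<Longrightarrow>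
      (Ident C A \<star>\<^bsub>M\<^esub> lunitor U B) \<cdot>\<^bsub>C\<^esub> assoc M A (unit_ob U) B
        = runitor U A \<star>\<^bsub>M\<^esub> Ident C B"
    and unit_symm: "munit M = Some U \<Longrightarrow> A \<in> Obj C \<Longrightarrow>
      lunitor U A \<cdot>\<^bsub>C\<^esub> symm M A (unit_ob U) = runitor U A"

text \<open>\<open>ev M X A\<close> is \<open>ev\<^sup>l : [X,A] \<otimes> X \<rightarrow> A\<close> and \<open>coev M X A\<close> is \<open>coev\<^sup>l : A \<rightarrow> [X, A \<otimes> X]\<close>.
  Naturality in \<open>X\<close> of the adjunctions is extranaturality of counit and unit.\<close>

locale symmetric_monoidal_closed_category =
  symmetric_monoidal_category C M + ihom: is_functor "prod_cat (op_cat C) C" C "ihom M"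
  for C :: "('o, 'a) cat" and M :: "('o, 'a) monoidal_closed" +
  assumes closed: "X \<in> Obj C \<Longrightarrow>
      adjunction C C (fix_snd C (tensor M) X) (fix_fst C (ihom M) X) (coev M X) (ev M X)"
    and ev_extranatural: "f \<in> Hom C X Y \<Longrightarrow> A \<in> Obj C \<Longrightarrow>
      ev M Y A \<cdot>\<^bsub>C\<^esub> (Ident C (ihom_ob M Y A) \<star>\<^bsub>M\<^esub> f)
        = ev M X A \<cdot>\<^bsub>C\<^esub> (ihom_ar M f (Ident C A) \<star>\<^bsub>M\<^esub> Ident C X)"
    and coev_extranatural: "f \<in> Hom C X Y \<Longrightarrow> A \<in> Obj C \<Longrightarrow>
      ihom_ar M (Ident C X) (Ident C A \<star>\<^bsub>M\<^esub> f) \<cdot>\<^bsub>C\<^esub> coev M X A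
        = ihom_ar M f (Ident C (A \<boxtimes>\<^bsub>M\<^esub> Y)) \<cdot>\<^bsub>C\<^esub> coev M Y A"

text \<open>\<open>\<iota> = None\<close> means that compatibility with units is not considered.\<close>

locale symmetric_monoidal_functor =
  source: symmetric_monoidal_category C M +
  target: symmetric_monoidal_category D N +
  is_functor C D F +
  natural_isomorphism "prod_cat C C" D "tensor N \<circ>\<^sub>F (F \<times>\<^sub>F F)" "F \<circ>\<^sub>F tensor M" "\<lambda>(A, B). \<alpha> A B"
  for C :: "('o, 'a) cat" and M :: "('o, 'a) monoidal_closed"
    and D :: "('p, 'b) cat" and N :: "('p, 'b) monoidal_closed"
    and F :: "('o, 'a, 'p, 'b) cfunctor" and \<alpha> :: "'o \<Rightarrow> 'o \<Rightarrow> 'b" +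
  fixes \<iota> :: "'b option"
  assumes \<alpha>_assoc: "A \<in> Obj C \<Longrightarrow> B \<in> Obj C \<Longrightarrow> E \<in> Obj C \<Longrightarrow>
      far F (assoc M A B E) \<cdot>\<^bsub>D\<^esub> \<alpha> (A \<boxtimes>\<^bsub>M\<^esub> B) E \<cdot>\<^bsub>D\<^esub> (\<alpha> A B \<star>\<^bsub>N\<^esub> Ident D (fob F E))
        = \<alpha> A (B \<boxtimes>\<^bsub>M\<^esub> E) \<cdot>\<^bsub>D\<^esub> (Ident D (fob F A) \<star>\<^bsub>N\<^esub> \<alpha> B E)
            \<cdot>\<^bsub>D\<^esub> assoc N (fob F A) (fob F B) (fob F E)"
    and \<alpha>_symm: "A \<in> Obj C \<Longrightarrow> B \<in> Obj C \<Longrightarrow>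
      far F (symm M A B) \<cdot>\<^bsub>D\<^esub> \<alpha> A B = \<alpha> B A \<cdot>\<^bsub>D\<^esub> symm N (fob F A) (fob F B)"
    and \<alpha>_unit: "\<iota> = Some i \<Longrightarrow> \<exists>U V. munit M = Some U \<and> munit N = Some V \<and>
      i \<in> Hom D (fob F (unit_ob U)) (unit_ob V) \<and> iso_arrow D i \<and>
      (\<forall>A \<in> Obj C.
        far F (lunitor U A) \<cdot>\<^bsub>D\<^esub> \<alpha> (unit_ob U) A
          = lunitor V (fob F A) \<cdot>\<^bsub>D\<^esub> (i \<star>\<^bsub>N\<^esub> Ident D (fob F A)) \<and>
        far F (runitor U A) \<cdot>\<^bsub>D\<^esub> \<alpha> A (unit_ob U)
          = runitor V (fob F A) \<cdot>\<^bsub>D\<^esub> (Ident D (fob F A) \<star>\<^bsub>N\<^esub> i))"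

definition beta :: "('o, 'a) monoidal_closed \<Rightarrow> ('p, 'b) cat \<Rightarrow> ('p, 'b) monoidal_closed \<Rightarrow>
    ('o, 'a, 'p, 'b) cfunctor \<Rightarrow> ('o \<Rightarrow> 'o \<Rightarrow> 'b) \<Rightarrow> 'o \<Rightarrow> 'o \<Rightarrow> 'b" where
  "beta M D N F \<alpha> A B =
     ihom_ar N (Ident D (fob F A)) (far F (ev M A B))
     \<cdot>\<^bsub>D\<^esub> ihom_ar N (Ident D (fob F A)) (\<alpha> (ihom_ob M A B) A)
     \<cdot>\<^bsub>D\<^esub> coev N (fob F A) (fob F (ihom_ob M A B))"


section \<open>Dualities\<close>

definition dual :: "('o, 'a) cat \<Rightarrow> ('o, 'a) monoidal_closed \<Rightarrow> 'o \<Rightarrow> ('o, 'a, 'o, 'a) cfunctor" where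
  "dual C M K = fix_snd C (ihom M) K"

definition ev_right :: "('o, 'a) cat \<Rightarrow> ('o, 'a) monoidal_closed \<Rightarrow> 'o \<Rightarrow> 'o \<Rightarrow> 'a" where
  "ev_right C M A K = ev M A K \<cdot>\<^bsub>C\<^esub> symm M A (ihom_ob M A K)"

text \<open>The adjunction \<open>(- \<otimes> X) \<stileturn> [X, -]\<close> takes \<open>g : A \<otimes> X \<rightarrow> B\<close> to
  \<open>[X, g] \<circ> coev\<^sup>l : A \<rightarrow> [X, B]\<close>; here \<open>X = [A, K]\<close> and \<open>g = ev\<^sup>r\<close>.\<close>

definition bidual :: "('o, 'a) cat \<Rightarrow> ('o, 'a) monoidal_closed \<Rightarrow> 'o \<Rightarrow> 'o \<Rightarrow> 'a" where
  "bidual C M K A =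
     ihom_ar M (Ident C (ihom_ob M A K)) (ev_right C M A K) \<cdot>\<^bsub>C\<^esub> coev M (ihom_ob M A K) A"

locale category_with_duality =
  adjunction C "op_cat C" D D \<omega> \<omega>
  for C :: "('o, 'a) cat" and D :: "('o, 'a, 'o, 'a) cfunctor" and \<omega> :: "'o \<Rightarrow> 'a"

locale duality_preserving_functor =
  source: category_with_duality C1 D1 \<omega>1 +
  target: category_with_duality C2 D2 \<omega>2 +
  is_functor C1 C2 F +
  natural_transformation "op_cat C1" C2 "F \<circ>\<^sub>F D1" "D2 \<circ>\<^sub>F F" \<phi>
  for C1 :: "('o, 'a) cat" and D1 :: "('o, 'a, 'o, 'a) cfunctor" and \<omega>1 :: "'o \<Rightarrow> 'a"
    and C2 :: "('p, 'b) cat" and D2 :: "('p, 'b, 'p, 'b) cfunctor" and \<omega>2 :: "'p \<Rightarrow> 'b"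
    and F :: "('o, 'a, 'p, 'b) cfunctor" and \<phi> :: "'o \<Rightarrow> 'b" +
  assumes duality_compat: "A \<in> Obj C1 \<Longrightarrow>
      \<phi> (fob D1 A) \<cdot>\<^bsub>C2\<^esub> far F (\<omega>1 A) = far D2 (\<phi> A) \<cdot>\<^bsub>C2\<^esub> \<omega>2 (fob F A)"


section \<open>Suspended categories\<close>

record ('o, 'a) suspension =
  Add :: "'a \<Rightarrow> 'a \<Rightarrow> 'a"
  Zero :: "'o \<Rightarrow> 'o \<Rightarrow> 'a"
  Susp :: "('o, 'a, 'o, 'a) cfunctor"
  Desusp :: "('o, 'a, 'o, 'a) cfunctor"

definition hom_group :: "('o, 'a) cat \<Rightarrow> ('o, 'a) suspension \<Rightarrow> 'o \<Rightarrow> 'o \<Rightarrow> 'a monoid" where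
  "hom_group C S A B = \<lparr>carrier = Hom C A B, monoid.mult = Add S, one = Zero S A B\<rparr>"

definition neg_arrow :: "('o, 'a) cat \<Rightarrow> ('o, 'a) suspension \<Rightarrow> 'a \<Rightarrow> 'a" where
  "neg_arrow C S f = m_inv (hom_group C S (Dom C f) (Cod C f)) f"

definition zero_object :: "('o, 'a) cat \<Rightarrow> 'o \<Rightarrow> bool" where
  "zero_object C Z \<longleftrightarrow> Z \<in> Obj C \<and>
     (\<forall>A \<in> Obj C. (\<exists>!f. f \<in> Hom C A Z) \<and> (\<exists>!f. f \<in> Hom C Z A))"

locale additive_category =
  category C for C :: "('o, 'a) cat" +
  fixes S :: "('o, 'a) suspension"
  assumes hom_comm_group: "A \<in> Obj C \<Longrightarrow> B \<in> Obj C \<Longrightarrow> comm_group (hom_group C S A B)"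
    and Comp_Add_right: "f \<in> Hom C A B \<Longrightarrow> f' \<in> Hom C A B \<Longrightarrow> g \<in> Hom C B E \<Longrightarrow>
      g \<cdot>\<^bsub>C\<^esub> Add S f f' = Add S (g \<cdot>\<^bsub>C\<^esub> f) (g \<cdot>\<^bsub>C\<^esub> f')"
    and Comp_Add_left: "f \<in> Hom C A B \<Longrightarrow> g \<in> Hom C B E \<Longrightarrow> g' \<in> Hom C B E \<Longrightarrow>
      Add S g g' \<cdot>\<^bsub>C\<^esub> f = Add S (g \<cdot>\<^bsub>C\<^esub> f) (g' \<cdot>\<^bsub>C\<^esub> f)"
    and zero_object_exists: "\<exists>Z. zero_object C Z"
    and biproduct_exists: "A \<in> Obj C \<Longrightarrow> B \<in> Obj C \<Longrightarrow>
      \<exists>P \<in> Obj C. \<exists>i \<in> Hom C A P. \<exists>j \<in> Hom C B P. \<exists>p \<in> Hom C P A. \<exists>q \<in> Hom C P B.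
        p \<cdot>\<^bsub>C\<^esub> i = Ident C A \<and> q \<cdot>\<^bsub>C\<^esub> j = Ident C B \<and>
        p \<cdot>\<^bsub>C\<^esub> j = Zero S B A \<and> q \<cdot>\<^bsub>C\<^esub> i = Zero S A B \<and>
        Add S (i \<cdot>\<^bsub>C\<^esub> p) (j \<cdot>\<^bsub>C\<^esub> q) = Ident C P"

locale suspended_category =
  additive_category C S + susp: is_functor C C "Susp S" + desusp: is_functor C C "Desusp S"
  for C :: "('o, 'a) cat" and S :: "('o, 'a) suspension" +
  assumes Susp_Desusp_ob: "A \<in> Obj C \<Longrightarrow> fob (Susp S) (fob (Desusp S) A) = A"
    and Desusp_Susp_ob: "A \<in> Obj C \<Longrightarrow> fob (Desusp S) (fob (Susp S) A) = A"
    and Susp_Desusp_ar: "f \<in> Arr C \<Longrightarrow> far (Susp S) (far (Desusp S) f) = f"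
    and Desusp_Susp_ar: "f \<in> Arr C \<Longrightarrow> far (Desusp S) (far (Susp S) f) = f"

definition op_susp :: "('o, 'a) suspension \<Rightarrow> ('o, 'a) suspension" where
  "op_susp S = \<lparr>Add = Add S, Zero = (\<lambda>A B. Zero S B A), Susp = Desusp S, Desusp = Susp S\<rparr>"

locale suspended_functor =
  source: suspended_category C S +
  target: suspended_category D R +
  natural_isomorphism C D "F \<circ>\<^sub>F Susp S" "Susp R \<circ>\<^sub>F F" \<phi> +
  is_functor C D F
  for C :: "('o, 'a) cat" and S :: "('o, 'a) suspension"
    and D :: "('p, 'b) cat" and R :: "('p, 'b) suspension"
    and F :: "('o, 'a, 'p, 'b) cfunctor" and \<phi> :: "'o \<Rightarrow> 'b"

text \<open>Isomorphisms \<open>FT \<rightarrow> TF\<close> for identity, composite and opposite functors. For the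
  last one, \<open>\<phi> : FT \<rightarrow> TF\<close> has components \<open>T\<inverse>\<phi>\<^bsub>T\<inverse>A\<^esub> : T\<inverse>FA \<rightarrow> FT\<inverse>A\<close>, which
  are arrows \<open>F\<^sup>oT\<inverse>A \<rightarrow> T\<inverse>F\<^sup>oA\<close> in the opposite category.\<close>

definition id_susp_iso :: "('o, 'a) cat \<Rightarrow> ('o, 'a) suspension \<Rightarrow> 'o \<Rightarrow> 'a" where
  "id_susp_iso C S A = Ident C (fob (Susp S) A)"

definition comp_susp_iso ::
  "('q, 'c) cat \<Rightarrow> ('p, 'b, 'q, 'c) cfunctor \<Rightarrow> ('p \<Rightarrow> 'c) \<Rightarrow>
   ('o, 'a, 'p, 'b) cfunctor \<Rightarrow> ('o \<Rightarrow> 'b) \<Rightarrow> 'o \<Rightarrow> 'c" where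
  "comp_susp_iso E G \<psi> F \<phi> A = \<psi> (fob F A) \<cdot>\<^bsub>E\<^esub> far G (\<phi> A)"

definition op_susp_iso ::
  "('o, 'a) suspension \<Rightarrow> ('p, 'b) suspension \<Rightarrow> ('o \<Rightarrow> 'b) \<Rightarrow> 'o \<Rightarrow> 'b" where
  "op_susp_iso S R \<phi> A = far (Desusp R) (\<phi> (fob (Desusp S) A))"

locale suspended_functor_morphism =
  F: suspended_functor C S D R F \<phi> +
  G: suspended_functor C S D R G \<psi> +
  natural_transformation C D F G \<eta>
  for C :: "('o, 'a) cat" and S :: "('o, 'a) suspension"
    and D :: "('p, 'b) cat" and R :: "('p, 'b) suspension"
    and F :: "('o, 'a, 'p, 'b) cfunctor" and \<phi> :: "'o \<Rightarrow> 'b"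
    and G :: "('o, 'a, 'p, 'b) cfunctor" and \<psi> :: "'o \<Rightarrow> 'b"
    and \<eta> :: "'o \<Rightarrow> 'b" +
  assumes commutes: "A \<in> Obj C \<Longrightarrow>
      far (Susp R) (\<eta> A) \<cdot>\<^bsub>D\<^esub> \<phi> A = \<psi> A \<cdot>\<^bsub>D\<^esub> \<eta> (fob (Susp S) A)"

locale suspended_bifunctor =
  fst: suspended_category C S +
  snd: suspended_category D R +
  target: suspended_category E Q +
  b1: natural_isomorphism "prod_cat C D" E "B \<circ>\<^sub>F (Susp S \<times>\<^sub>F id_functor)" "Susp Q \<circ>\<^sub>F B"
        "\<lambda>(X, Y). b1 X Y" +
  b2: natural_isomorphism "prod_cat C D" E "B \<circ>\<^sub>F (id_functor \<times>\<^sub>F Susp R)" "Susp Q \<circ>\<^sub>F B"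
        "\<lambda>(X, Y). b2 X Y" +
  is_functor "prod_cat C D" E B
  for C :: "('o, 'a) cat" and S :: "('o, 'a) suspension"
    and D :: "('p, 'b) cat" and R :: "('p, 'b) suspension"
    and E :: "('q, 'c) cat" and Q :: "('q, 'c) suspension"
    and B :: "('o \<times> 'p, 'a \<times> 'b, 'q, 'c) cfunctor"
    and b1 :: "'o \<Rightarrow> 'p \<Rightarrow> 'c" and b2 :: "'o \<Rightarrow> 'p \<Rightarrow> 'c" +
  assumes anticommute: "X \<in> Obj C \<Longrightarrow> Y \<in> Obj D \<Longrightarrow>
      far (Susp Q) (b1 X Y) \<cdot>\<^bsub>E\<^esub> b2 (fob (Susp S) X) Y
        = neg_arrow E Q (far (Susp Q) (b2 X Y) \<cdot>\<^bsub>E\<^esub> b1 X (fob (Susp R) Y))"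

text \<open>Commutation of a natural transformation with the structure isomorphisms of bifunctors.\<close>

locale suspended_bifunctor_morphism =
  natural_transformation "prod_cat C D" E B B' "\<lambda>(X, Y). \<eta> X Y"
  for C :: "('o, 'a) cat" and S :: "('o, 'a) suspension"
    and D :: "('p, 'b) cat" and R :: "('p, 'b) suspension"
    and E :: "('q, 'c) cat" and Q :: "('q, 'c) suspension"
    and B :: "('o \<times> 'p, 'a \<times> 'b, 'q, 'c) cfunctor"
    and b1 :: "'o \<Rightarrow> 'p \<Rightarrow> 'c" and b2 :: "'o \<Rightarrow> 'p \<Rightarrow> 'c"
    and B' :: "('o \<times> 'p, 'a \<times> 'b, 'q, 'c) cfunctor"
    and b1' :: "'o \<Rightarrow> 'p \<Rightarrow> 'c" and b2' :: "'o \<Rightarrow> 'p \<Rightarrow> 'c"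
    and \<eta> :: "'o \<Rightarrow> 'p \<Rightarrow> 'c" +
  assumes commutes_b1: "X \<in> Obj C \<Longrightarrow> Y \<in> Obj D \<Longrightarrow>
      far (Susp Q) (\<eta> X Y) \<cdot>\<^bsub>E\<^esub> b1 X Y = b1' X Y \<cdot>\<^bsub>E\<^esub> \<eta> (fob (Susp S) X) Y"
    and commutes_b2: "X \<in> Obj C \<Longrightarrow> Y \<in> Obj D \<Longrightarrow>
      far (Susp Q) (\<eta> X Y) \<cdot>\<^bsub>E\<^esub> b2 X Y = b2' X Y \<cdot>\<^bsub>E\<^esub> \<eta> X (fob (Susp R) Y)"

locale suspended_symmetric_monoidal_closed_category =
  symmetric_monoidal_closed_category C M +
  suspended_bifunctor C S C S C S "tensor M" tp1 tp2
  for C :: "('o, 'a) cat" and M :: "('o, 'a) monoidal_closed" and S :: "('o, 'a) suspension"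
    and tp1 :: "'o \<Rightarrow> 'o \<Rightarrow> 'a" and tp2 :: "'o \<Rightarrow> 'o \<Rightarrow> 'a" +
  assumes assoc_susp_1: "X \<in> Obj C \<Longrightarrow> Y \<in> Obj C \<Longrightarrow> Z \<in> Obj C \<Longrightarrow>
      far (Susp S) (assoc M X Y Z) \<cdot>\<^bsub>C\<^esub> tp1 (X \<boxtimes>\<^bsub>M\<^esub> Y) Z \<cdot>\<^bsub>C\<^esub> (tp1 X Y \<star>\<^bsub>M\<^esub> Ident C Z)
        = tp1 X (Y \<boxtimes>\<^bsub>M\<^esub> Z) \<cdot>\<^bsub>C\<^esub> assoc M (fob (Susp S) X) Y Z"
    and assoc_susp_2: "X \<in> Obj C \<Longrightarrow> Y \<in> Obj C \<Longrightarrow> Z \<in> Obj C \<Longrightarrow>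
      far (Susp S) (assoc M X Y Z) \<cdot>\<^bsub>C\<^esub> tp1 (X \<boxtimes>\<^bsub>M\<^esub> Y) Z \<cdot>\<^bsub>C\<^esub> (tp2 X Y \<star>\<^bsub>M\<^esub> Ident C Z)
        = tp2 X (Y \<boxtimes>\<^bsub>M\<^esub> Z) \<cdot>\<^bsub>C\<^esub> (Ident C X \<star>\<^bsub>M\<^esub> tp1 Y Z)
            \<cdot>\<^bsub>C\<^esub> assoc M X (fob (Susp S) Y) Z"
    and assoc_susp_3: "X \<in> Obj C \<Longrightarrow> Y \<in> Obj C \<Longrightarrow> Z \<in> Obj C \<Longrightarrow>
      far (Susp S) (assoc M X Y Z) \<cdot>\<^bsub>C\<^esub> tp2 (X \<boxtimes>\<^bsub>M\<^esub> Y) Z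
        = tp2 X (Y \<boxtimes>\<^bsub>M\<^esub> Z) \<cdot>\<^bsub>C\<^esub> (Ident C X \<star>\<^bsub>M\<^esub> tp2 Y Z)
            \<cdot>\<^bsub>C\<^esub> assoc M X Y (fob (Susp S) Z)"
    and symm_susp: "X \<in> Obj C \<Longrightarrow> Y \<in> Obj C \<Longrightarrow>
      far (Susp S) (symm M X Y) \<cdot>\<^bsub>C\<^esub> tp1 X Y = tp2 Y X \<cdot>\<^bsub>C\<^esub> symm M (fob (Susp S) X) Y"

text \<open>The unique \<open>th\<^sub>1 : [T\<inverse>A, K] \<rightarrow> T[A, K]\<close> such that \<open>ev\<^sup>l \<circ> (T\<inverse>th\<^sub>1 \<otimes> id)\<close> is the composition
  \<open>T\<inverse>[T\<inverse>A, K] \<otimes> TT\<inverse>A \<rightarrow> T(T\<inverse>[T\<inverse>A, K] \<otimes> T\<inverse>A) \<rightarrow> [T\<inverse>A, K] \<otimes> T\<inverse>A \<rightarrow> K\<close>.\<close>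

definition th1 :: "('o, 'a) cat \<Rightarrow> ('o, 'a) monoidal_closed \<Rightarrow> ('o, 'a) suspension \<Rightarrow>
    ('o \<Rightarrow> 'o \<Rightarrow> 'a) \<Rightarrow> ('o \<Rightarrow> 'o \<Rightarrow> 'a) \<Rightarrow> 'o \<Rightarrow> 'o \<Rightarrow> 'a" where
  "th1 C M S tp1 tp2 A K =
     (let A' = fob (Desusp S) A; H = ihom_ob M A' K; H' = fob (Desusp S) H in
      THE h. h \<in> Hom C H (fob (Susp S) (ihom_ob M A K)) \<and>
        ev M A K \<cdot>\<^bsub>C\<^esub> (far (Desusp S) h \<star>\<^bsub>M\<^esub> Ident C A)
          = ev M A' K \<cdot>\<^bsub>C\<^esub> inv_arrow C (tp1 H' A') \<cdot>\<^bsub>C\<^esub> tp2 H' A')"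

text \<open>The hypotheses on \<open>\<alpha>\<close> say that \<open>f\<^sup>*A \<otimes> f\<^sup>*B \<rightarrow> f\<^sup>*(A \<otimes> B)\<close> commutes with the
  isomorphisms induced on both sides by \<open>\<phi> : f\<^sup>*T \<rightarrow> Tf\<^sup>*\<close> and those of \<open>\<otimes>\<close>.\<close>

locale suspended_symmetric_monoidal_functor =
  symmetric_monoidal_functor C M D N F \<alpha> \<iota> +
  suspended_functor C S D R F \<phi> +
  suspended_bifunctor_morphism C S C S D R
    "tensor N \<circ>\<^sub>F (F \<times>\<^sub>F F)"
    "\<lambda>X Y. tq1 (fob F X) (fob F Y) \<cdot>\<^bsub>D\<^esub> (\<phi> X \<star>\<^bsub>N\<^esub> Ident D (fob F Y))"
    "\<lambda>X Y. tq2 (fob F X) (fob F Y) \<cdot>\<^bsub>D\<^esub> (Ident D (fob F X) \<star>\<^bsub>N\<^esub> \<phi> Y)"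
    "F \<circ>\<^sub>F tensor M"
    "\<lambda>X Y. \<phi> (X \<boxtimes>\<^bsub>M\<^esub> Y) \<cdot>\<^bsub>D\<^esub> far F (tp1 X Y)"
    "\<lambda>X Y. \<phi> (X \<boxtimes>\<^bsub>M\<^esub> Y) \<cdot>\<^bsub>D\<^esub> far F (tp2 X Y)"
    \<alpha>
  for C :: "('o, 'a) cat" and M :: "('o, 'a) monoidal_closed" and S :: "('o, 'a) suspension"
    and tp1 :: "'o \<Rightarrow> 'o \<Rightarrow> 'a" and tp2 :: "'o \<Rightarrow> 'o \<Rightarrow> 'a"
    and D :: "('p, 'b) cat" and N :: "('p, 'b) monoidal_closed" and R :: "('p, 'b) suspension"
    and tq1 :: "'p \<Rightarrow> 'p \<Rightarrow> 'b" and tq2 :: "'p \<Rightarrow> 'p \<Rightarrow> 'b"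
    and F :: "('o, 'a, 'p, 'b) cfunctor" and \<phi> :: "'o \<Rightarrow> 'b"
    and \<alpha> :: "'o \<Rightarrow> 'o \<Rightarrow> 'b" and \<iota> :: "'b option"

text \<open>The suspended structure of the duality is the isomorphism \<open>d : D\<^sup>oT\<inverse> \<rightarrow> TD\<^sup>o\<close> of
  \<open>D\<^sup>o : op_cat C \<rightarrow> C\<close>; that of \<open>D : C \<rightarrow> op_cat C\<close> is its opposite.\<close>

locale suspended_category_with_duality =
  category_with_duality C D \<omega> +
  suspended_category C S +
  suspended_functor C S "op_cat C" "op_susp S" D "op_susp_iso (op_susp S) S d" +
  opp: suspended_functor "op_cat C" "op_susp S" C S D d +
  suspended_functor_morphism C S C S id_functor "id_susp_iso C S"
    "D \<circ>\<^sub>F D" "comp_susp_iso C D d D (op_susp_iso (op_susp S) S d)" \<omega>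
  for C :: "('o, 'a) cat" and S :: "('o, 'a) suspension"
    and D :: "('o, 'a, 'o, 'a) cfunctor" and d :: "'o \<Rightarrow> 'a" and \<omega> :: "'o \<Rightarrow> 'a"

locale suspended_duality_preserving_functor =
  source: suspended_category_with_duality C1 S1 D1 d1 \<omega>1 +
  target: suspended_category_with_duality C2 S2 D2 d2 \<omega>2 +
  duality_preserving_functor C1 D1 \<omega>1 C2 D2 \<omega>2 F \<beta> +
  suspended_functor C1 S1 C2 S2 F \<phi> +
  suspended_functor_morphism "op_cat C1" "op_susp S1" C2 S2
    "F \<circ>\<^sub>F D1" "comp_susp_iso C2 F \<phi> D1 d1"
    "D2 \<circ>\<^sub>F F" "comp_susp_iso C2 D2 d2 F (op_susp_iso S1 S2 \<phi>)" \<beta>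
  for C1 :: "('o, 'a) cat" and S1 :: "('o, 'a) suspension"
    and D1 :: "('o, 'a, 'o, 'a) cfunctor" and d1 :: "'o \<Rightarrow> 'a" and \<omega>1 :: "'o \<Rightarrow> 'a"
    and C2 :: "('p, 'b) cat" and S2 :: "('p, 'b) suspension"
    and D2 :: "('p, 'b, 'p, 'b) cfunctor" and d2 :: "'p \<Rightarrow> 'b" and \<omega>2 :: "'p \<Rightarrow> 'b"
    and F :: "('o, 'a, 'p, 'b) cfunctor" and \<phi> :: "'o \<Rightarrow> 'b" and \<beta> :: "'o \<Rightarrow> 'b"


section \<open>Triangulated categories\<close>

text \<open>\<open>\<Delta>\<close> is the set of exact triangles \<open>(u, v, w)\<close>, \<open>A \<rightarrow> B \<rightarrow> E \<rightarrow> TA\<close>.\<close>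

definition is_triangle :: "('o, 'a) cat \<Rightarrow> ('o, 'a) suspension \<Rightarrow> 'a \<Rightarrow> 'a \<Rightarrow> 'a \<Rightarrow> bool" where
  "is_triangle C S u v w \<longleftrightarrow> u \<in> Arr C \<and> v \<in> Hom C (Cod C u) (Dom C w) \<and>
     w \<in> Hom C (Cod C v) (fob (Susp S) (Dom C u))"

definition triangle_morphism :: "('o, 'a) cat \<Rightarrow> ('o, 'a) suspension \<Rightarrow>
    'a \<times> 'a \<times> 'a \<Rightarrow> 'a \<times> 'a \<times> 'a \<Rightarrow> 'a \<Rightarrow> 'a \<Rightarrow> 'a \<Rightarrow> bool" where
  "triangle_morphism C S = (\<lambda>(u, v, w) (u', v', w') a b c.
     a \<in> Hom C (Dom C u) (Dom C u') \<and> b \<in> Hom C (Dom C v) (Dom C v') \<and>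
     c \<in> Hom C (Dom C w) (Dom C w') \<and>
     b \<cdot>\<^bsub>C\<^esub> u = u' \<cdot>\<^bsub>C\<^esub> a \<and> c \<cdot>\<^bsub>C\<^esub> v = v' \<cdot>\<^bsub>C\<^esub> b \<and> far (Susp S) a \<cdot>\<^bsub>C\<^esub> w = w' \<cdot>\<^bsub>C\<^esub> c)"

locale triangulated_category =
  suspended_category C S
  for C :: "('o, 'a) cat" and S :: "('o, 'a) suspension" +
  fixes \<Delta> :: "('a \<times> 'a \<times> 'a) set"
  assumes exact_is_triangle: "(u, v, w) \<in> \<Delta> \<Longrightarrow> is_triangle C S u v w"
    and exact_iso: "(u, v, w) \<in> \<Delta> \<Longrightarrow> is_triangle C S u' v' w' \<Longrightarrow>
      triangle_morphism C S (u, v, w) (u', v', w') a b c \<Longrightarrow>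
      iso_arrow C a \<Longrightarrow> iso_arrow C b \<Longrightarrow> iso_arrow C c \<Longrightarrow> (u', v', w') \<in> \<Delta>"
    and exact_Ident: "A \<in> Obj C \<Longrightarrow> zero_object C Z \<Longrightarrow>
      (Ident C A, Zero S A Z, Zero S Z (fob (Susp S) A)) \<in> \<Delta>"
    and exact_extend: "u \<in> Arr C \<Longrightarrow> \<exists>v w. (u, v, w) \<in> \<Delta>"
    and exact_rotate: "is_triangle C S u v w \<Longrightarrow>
      (u, v, w) \<in> \<Delta> \<longleftrightarrow> (v, w, neg_arrow C S (far (Susp S) u)) \<in> \<Delta>"
    and exact_morphism: "(u, v, w) \<in> \<Delta> \<Longrightarrow> (u', v', w') \<in> \<Delta> \<Longrightarrow>
      a \<in> Hom C (Dom C u) (Dom C u') \<Longrightarrow> b \<in> Hom C (Cod C u) (Cod C u') \<Longrightarrow>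
      b \<cdot>\<^bsub>C\<^esub> u = u' \<cdot>\<^bsub>C\<^esub> a \<Longrightarrow> \<exists>c. triangle_morphism C S (u, v, w) (u', v', w') a b c"
    and octahedral: "u \<in> Hom C A B \<Longrightarrow> v \<in> Hom C B E \<Longrightarrow>
      (u, j, k) \<in> \<Delta> \<Longrightarrow> (v, l, i) \<in> \<Delta> \<Longrightarrow> (v \<cdot>\<^bsub>C\<^esub> u, m, n) \<in> \<Delta> \<Longrightarrow>
      \<exists>f g. (f, g, far (Susp S) j \<cdot>\<^bsub>C\<^esub> i) \<in> \<Delta> \<and>
        f \<in> Hom C (Cod C j) (Cod C m) \<and> g \<in> Hom C (Cod C m) (Cod C l) \<and>
        f \<cdot>\<^bsub>C\<^esub> j = m \<cdot>\<^bsub>C\<^esub> v \<and> n \<cdot>\<^bsub>C\<^esub> f = k \<and> g \<cdot>\<^bsub>C\<^esub> m = l \<and>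
        i \<cdot>\<^bsub>C\<^esub> g = far (Susp S) u \<cdot>\<^bsub>C\<^esub> n"

text \<open>With these exact triangles on \<open>op_cat C\<close>, exactness of a functor on \<open>op_cat C\<close> is the
  contravariant exactness convention: \<open>(u, v, w)\<close> is sent to \<open>(Fv, Fu, \<phi>\<^bsub>E\<^esub> \<circ> FT\<inverse>w)\<close> for
  \<open>w : E \<rightarrow> TA\<close>.\<close>

definition op_triangles :: "('o, 'a) suspension \<Rightarrow> ('a \<times> 'a \<times> 'a) set \<Rightarrow> ('a \<times> 'a \<times> 'a) set" where
  "op_triangles S \<Delta> = {(v, u, far (Desusp S) w) | u v w. (u, v, w) \<in> \<Delta>}"

locale exact_functor =
  suspended_functor C S D R F \<phi>
  for C :: "('o, 'a) cat" and S :: "('o, 'a) suspension" and \<Delta> :: "('a \<times> 'a \<times> 'a) set"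
    and D :: "('p, 'b) cat" and R :: "('p, 'b) suspension" and \<Delta>' :: "('b \<times> 'b \<times> 'b) set"
    and F :: "('o, 'a, 'p, 'b) cfunctor" and \<phi> :: "'o \<Rightarrow> 'b" +
  assumes exact: "(u, v, w) \<in> \<Delta> \<Longrightarrow> (far F u, far F v, \<phi> (Dom C u) \<cdot>\<^bsub>D\<^esub> far F w) \<in> \<Delta>'"

locale triangulated_symmetric_monoidal_closed_category =
  suspended_symmetric_monoidal_closed_category C M S tp1 tp2 +
  triangulated_category C S \<Delta>
  for C :: "('o, 'a) cat" and M :: "('o, 'a) monoidal_closed" and S :: "('o, 'a) suspension"
    and tp1 :: "'o \<Rightarrow> 'o \<Rightarrow> 'a" and tp2 :: "'o \<Rightarrow> 'o \<Rightarrow> 'a" and \<Delta> :: "('a \<times> 'a \<times> 'a) set" +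
  assumes tensor_exact_fst: "Y \<in> Obj C \<Longrightarrow>
      exact_functor C S \<Delta> C S \<Delta> (fix_snd C (tensor M) Y) (\<lambda>X. tp1 X Y)"
    and tensor_exact_snd: "X \<in> Obj C \<Longrightarrow>
      exact_functor C S \<Delta> C S \<Delta> (fix_fst C (tensor M) X) (\<lambda>Y. tp2 X Y)"
    and ihom_exact_fst: "K \<in> Obj C \<Longrightarrow>
      exact_functor (op_cat C) (op_susp S) (op_triangles S \<Delta>) C S \<Delta>
        (fix_snd C (ihom M) K) (\<lambda>A. th1 C M S tp1 tp2 A K)"

locale triangulated_symmetric_monoidal_functor =
  suspended_symmetric_monoidal_functor C M S tp1 tp2 D N R tq1 tq2 F \<phi> \<alpha> \<iota> +
  exact_functor C S \<Delta> D R \<Delta>' F \<phi>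
  for C :: "('o, 'a) cat" and M :: "('o, 'a) monoidal_closed" and S :: "('o, 'a) suspension"
    and tp1 :: "'o \<Rightarrow> 'o \<Rightarrow> 'a" and tp2 :: "'o \<Rightarrow> 'o \<Rightarrow> 'a" and \<Delta> :: "('a \<times> 'a \<times> 'a) set"
    and D :: "('p, 'b) cat" and N :: "('p, 'b) monoidal_closed" and R :: "('p, 'b) suspension"
    and tq1 :: "'p \<Rightarrow> 'p \<Rightarrow> 'b" and tq2 :: "'p \<Rightarrow> 'p \<Rightarrow> 'b" and \<Delta>' :: "('b \<times> 'b \<times> 'b) set"
    and F :: "('o, 'a, 'p, 'b) cfunctor" and \<phi> :: "'o \<Rightarrow> 'b"
    and \<alpha> :: "'o \<Rightarrow> 'o \<Rightarrow> 'b" and \<iota> :: "'b option"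

locale triangulated_category_with_duality =
  suspended_category_with_duality C S D d \<omega> +
  triangulated_category C S \<Delta> +
  exact_functor C S \<Delta> "op_cat C" "op_susp S" "op_triangles S \<Delta>"
    D "op_susp_iso (op_susp S) S d" +
  opp: exact_functor "op_cat C" "op_susp S" "op_triangles S \<Delta>" C S \<Delta> D d
  for C :: "('o, 'a) cat" and S :: "('o, 'a) suspension" and \<Delta> :: "('a \<times> 'a \<times> 'a) set"
    and D :: "('o, 'a, 'o, 'a) cfunctor" and d :: "'o \<Rightarrow> 'a" and \<omega> :: "'o \<Rightarrow> 'a"

locale triangulated_duality_preserving_functor =
  source: triangulated_category_with_duality C1 S1 \<Delta>1 D1 d1 \<omega>1 +
  target: triangulated_category_with_duality C2 S2 \<Delta>2 D2 d2 \<omega>2 +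
  suspended_duality_preserving_functor C1 S1 D1 d1 \<omega>1 C2 S2 D2 d2 \<omega>2 F \<phi> \<beta> +
  exact_functor C1 S1 \<Delta>1 C2 S2 \<Delta>2 F \<phi>
  for C1 :: "('o, 'a) cat" and S1 :: "('o, 'a) suspension" and \<Delta>1 :: "('a \<times> 'a \<times> 'a) set"
    and D1 :: "('o, 'a, 'o, 'a) cfunctor" and d1 :: "'o \<Rightarrow> 'a" and \<omega>1 :: "'o \<Rightarrow> 'a"
    and C2 :: "('p, 'b) cat" and S2 :: "('p, 'b) suspension" and \<Delta>2 :: "('b \<times> 'b \<times> 'b) set"
    and D2 :: "('p, 'b, 'p, 'b) cfunctor" and d2 :: "'p \<Rightarrow> 'b" and \<omega>2 :: "'p \<Rightarrow> 'b"
    and F :: "('o, 'a, 'p, 'b) cfunctor" and \<phi> :: "'o \<Rightarrow> 'b" and \<beta> :: "'o \<Rightarrow> 'b"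

end

theory Submission
  imports Defs
begin

text \<open>Two arrows into an internal Hom \<open>[X, A]\<close> agree as soon as they agree after tensoring with
  \<open>X\<close> and evaluating. Under this transposition \<open>\<varpi>\<close> becomes \<open>ev\<^sup>l \<circ> s\<close>, \<open>\<beta>\<close> becomes
  \<open>f\<^sup>*ev\<^sup>l \<circ> \<alpha>\<close> and the action of an arrow on the first variable of \<open>[-, K]\<close> moves across the
  tensor product, so the duality axioms reduce to naturality and symmetry of \<open>\<alpha>\<close>. In the suspended
  case \<open>T\<inverse>th\<^sub>1\<close> becomes \<open>ev\<^sup>l\<close> composed with the shift \<open>tp\<^sub>1\<inverse> \<circ> tp\<^sub>2 : X \<otimes> TY \<rightarrow> TX \<otimes> Y\<close>, and it
  suffices that this shift is natural, self-inverse up to symmetry, and compatible with \<open>\<alpha>\<close> and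
  \<open>\<phi>\<close>. In the triangulated case exactness of \<open>D\<^sub>K\<close> follows from that of \<open>D\<^sub>K\<^sup>o\<close> by naturality
  of \<open>th\<^sub>1\<close>.\<close>

section \<open>Opposites and composites\<close>

lemma op_cat_simps [simp]:
  "Obj (op_cat C) = Obj C" "Arr (op_cat C) = Arr C" "Dom (op_cat C) = Cod C"
  "Cod (op_cat C) = Dom C" "Ident (op_cat C) = Ident C" "g \<cdot>\<^bsub>op_cat C\<^esub> f = f \<cdot>\<^bsub>C\<^esub> g"
  by (simp_all add: op_cat_def)

lemma op_op_cat [simp]: "op_cat (op_cat C) = C"
  by (simp add: op_cat_def)

lemma Hom_op_cat [simp]: "Hom (op_cat C) A B = Hom C B A"
  by (auto simp: Hom_def)

lemma prod_cat_simps [simp]: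
  "Obj (prod_cat C D) = Obj C \<times> Obj D" "Arr (prod_cat C D) = Arr C \<times> Arr D"
  "Dom (prod_cat C D) (f, g) = (Dom C f, Dom D g)"
  "Cod (prod_cat C D) (f, g) = (Cod C f, Cod D g)"
  "Ident (prod_cat C D) (A, B) = (Ident C A, Ident D B)"
  "(f, g) \<cdot>\<^bsub>prod_cat C D\<^esub> (f', g') = (f \<cdot>\<^bsub>C\<^esub> f', g \<cdot>\<^bsub>D\<^esub> g')"
  by (simp_all add: prod_cat_def)

lemma functor_simps [simp]:
  "fob id_functor A = A" "far id_functor f = f"
  "fob (G \<circ>\<^sub>F F) A = fob G (fob F A)" "far (G \<circ>\<^sub>F F) f = far G (far F f)"
  "fob (prod_functor F F') (A, B) = (fob F A, fob F' B)"
  "far (prod_functor F F') (f, g) = (far F f, far F' g)"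
  "fob (fix_fst C H A) B = fob H (A, B)" "far (fix_fst C H A) g = far H (Ident C A, g)"
  "fob (fix_snd D H B) A = fob H (A, B)" "far (fix_snd D H B) f = far H (f, Ident D B)"
  by (simp_all add: id_functor_def comp_functor_def prod_functor_def fix_fst_def fix_snd_def)

lemma op_susp_simps [simp]:
  "Add (op_susp S) = Add S" "Zero (op_susp S) A B = Zero S B A"
  "Susp (op_susp S) = Desusp S" "Desusp (op_susp S) = Susp S"
  by (simp_all add: op_susp_def)

lemma op_op_susp [simp]: "op_susp (op_susp S) = S"
  by (simp add: op_susp_def)

section \<open>Composition and inverse arrows in a category\<close>

context category
begin

lemma Dom_Cod_Obj [simp]: "f \<in> Arr C \<Longrightarrow> Dom C f \<in> Obj C" "f \<in> Arr C \<Longrightarrow> Cod C f \<in> Obj C"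
  by (fact Dom_Obj Cod_Obj)+

lemma Ident_simps [simp]:
  assumes "A \<in> Obj C"
  shows "Ident C A \<in> Arr C" "Dom C (Ident C A) = A" "Cod C (Ident C A) = A"
  using Ident_Hom [OF assms] by (simp_all add: Hom_def)

lemma Comp_simps [simp]:
  assumes "f \<in> Arr C" "g \<in> Arr C" "Dom C g = Cod C f"
  shows "g \<cdot>\<^bsub>C\<^esub> f \<in> Arr C" "Dom C (g \<cdot>\<^bsub>C\<^esub> f) = Dom C f" "Cod C (g \<cdot>\<^bsub>C\<^esub> f) = Cod C g"
  using Comp_Hom [of f "Dom C f" "Cod C f" g "Cod C g"] assms by (simp_all add: Hom_def)

lemma Comp_Ident_simp [simp]: "f \<in> Arr C \<Longrightarrow> Dom C f = A \<Longrightarrow> f \<cdot>\<^bsub>C\<^esub> Ident C A = f"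
  by (rule Comp_Ident) (simp add: Hom_def)

lemma Ident_Comp_simp [simp]: "f \<in> Arr C \<Longrightarrow> Cod C f = B \<Longrightarrow> Ident C B \<cdot>\<^bsub>C\<^esub> f = f"
  by (rule Ident_Comp) (simp add: Hom_def)

lemma Comp_assoc_simp [simp]:
  "f \<in> Arr C \<Longrightarrow> g \<in> Arr C \<Longrightarrow> h \<in> Arr C \<Longrightarrow> Dom C g = Cod C f \<Longrightarrow> Dom C h = Cod C g \<Longrightarrow>
    (h \<cdot>\<^bsub>C\<^esub> g) \<cdot>\<^bsub>C\<^esub> f = h \<cdot>\<^bsub>C\<^esub> g \<cdot>\<^bsub>C\<^esub> f"
  by (rule Comp_assoc) (simp_all add: Hom_def)

text \<open>Composites are normalised to the right, so in \<open>h \<cdot> g \<cdot> f\<close> the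
  pair \<open>h \<cdot> g\<close> is not a subterm. This form lets an equation for the pair act in
  front of a further factor.\<close>

lemma Comp_rewrite:
  assumes "h \<cdot>\<^bsub>C\<^esub> g = k" "f \<in> Arr C" "g \<in> Arr C" "h \<in> Arr C" "Dom C g = Cod C f" "Dom C h = Cod C g"
  shows "h \<cdot>\<^bsub>C\<^esub> g \<cdot>\<^bsub>C\<^esub> f = k \<cdot>\<^bsub>C\<^esub> f"
  using assms by (metis Comp_assoc_simp)

lemma inverse_arrows_unique:
  assumes "inverse_arrows C f g" "inverse_arrows C f h"
  shows "g = h"
proof -
  have "g = (h \<cdot>\<^bsub>C\<^esub> f) \<cdot>\<^bsub>C\<^esub> g"
    using assms by (simp del: Comp_assoc_simp add: inverse_arrows_def Hom_def)
  also have "\<dots> = h \<cdot>\<^bsub>C\<^esub> f \<cdot>\<^bsub>C\<^esub> g"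
    using assms by (intro Comp_assoc_simp) (simp_all add: inverse_arrows_def Hom_def)
  also have "\<dots> = h"
    using assms by (simp add: inverse_arrows_def Hom_def)
  finally show ?thesis .
qed

lemma inverse_arrows_inv:
  assumes "iso_arrow C f"
  shows "inverse_arrows C f (inv_arrow C f)"
  using assms inverse_arrows_unique unfolding iso_arrow_def inv_arrow_def by (metis theI)

lemma inv_simps [simp]:
  assumes "iso_arrow C f"
  shows "inv_arrow C f \<in> Arr C" "Dom C (inv_arrow C f) = Cod C f" "Cod C (inv_arrow C f) = Dom C f"
    "inv_arrow C f \<cdot>\<^bsub>C\<^esub> f = Ident C (Dom C f)" "f \<cdot>\<^bsub>C\<^esub> inv_arrow C f = Ident C (Cod C f)"
  using inverse_arrows_inv [OF assms] by (simp_all add: inverse_arrows_def Hom_def)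

lemma iso_Arr: "iso_arrow C f \<Longrightarrow> f \<in> Arr C"
  by (auto simp: iso_arrow_def inverse_arrows_def)

lemma inv_cancel [simp]:
  assumes "iso_arrow C f" "g \<in> Arr C"
  shows "Cod C g = Dom C f \<Longrightarrow> inv_arrow C f \<cdot>\<^bsub>C\<^esub> f \<cdot>\<^bsub>C\<^esub> g = g"
    "Cod C g = Cod C f \<Longrightarrow> f \<cdot>\<^bsub>C\<^esub> inv_arrow C f \<cdot>\<^bsub>C\<^esub> g = g"
  using assms by (simp_all add: iso_Arr flip: Comp_assoc_simp)

lemma iso_arrowI:
  assumes "f \<in> Arr C" "g \<in> Arr C" "Dom C g = Cod C f" "Cod C g = Dom C f"
    "g \<cdot>\<^bsub>C\<^esub> f = Ident C (Dom C f)" "f \<cdot>\<^bsub>C\<^esub> g = Ident C (Cod C f)"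
  shows "iso_arrow C f"
  using assms by (auto simp: iso_arrow_def inverse_arrows_def Hom_def)

lemma iso_Comp [simp]:
  assumes "iso_arrow C f" "iso_arrow C g" "Dom C g = Cod C f"
  shows "iso_arrow C (g \<cdot>\<^bsub>C\<^esub> f)"
  by (rule iso_arrowI [of _ "inv_arrow C f \<cdot>\<^bsub>C\<^esub> inv_arrow C g"]) (simp_all add: assms iso_Arr)

lemma iso_inv [simp]: "iso_arrow C f \<Longrightarrow> iso_arrow C (inv_arrow C f)"
  by (rule iso_arrowI [of _ f]) (simp_all add: iso_Arr)

lemma iso_Ident [simp]: "A \<in> Obj C \<Longrightarrow> iso_arrow C (Ident C A)"
  by (rule iso_arrowI [of _ "Ident C A"]) simp_all

text \<open>Composing a commutative square with the inverses of two parallel sides gives a square of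
  inverses. In this way naturality of \<open>tp1\<close>, and later of \<open>susp_shift\<close>,
  passes to the inverse arrows.\<close>

lemma Comp_inv_swap:
  assumes "f' \<cdot>\<^bsub>C\<^esub> g = g' \<cdot>\<^bsub>C\<^esub> f" "iso_arrow C f" "iso_arrow C f'"
    "g \<in> Arr C" "g' \<in> Arr C" "Cod C g = Dom C f'" "Dom C g' = Cod C f" "Dom C g = Dom C f"
  shows "g \<cdot>\<^bsub>C\<^esub> inv_arrow C f = inv_arrow C f' \<cdot>\<^bsub>C\<^esub> g'"
proof -
  have "g \<cdot>\<^bsub>C\<^esub> inv_arrow C f = inv_arrow C f' \<cdot>\<^bsub>C\<^esub> (f' \<cdot>\<^bsub>C\<^esub> g) \<cdot>\<^bsub>C\<^esub> inv_arrow C f"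
    using assms(2-) by (simp add: iso_Arr)
  also have "\<dots> = inv_arrow C f' \<cdot>\<^bsub>C\<^esub> (g' \<cdot>\<^bsub>C\<^esub> f) \<cdot>\<^bsub>C\<^esub> inv_arrow C f"
    by (simp only: assms(1))
  also have "\<dots> = inv_arrow C f' \<cdot>\<^bsub>C\<^esub> g'"
  proof -
    \<comment> \<open>The codomain of \<open>g'\<close> is read off from the two composites of the
      square.\<close>
    have "Cod C g' = Cod C f'"
      using arg_cong [OF assms(1), of "Cod C"] assms(2-) by (simp add: iso_Arr)
    then show ?thesis
      using assms(2-) by (simp add: iso_Arr)
  qed
  finally show ?thesis .
qed

lemma category_op: "category (op_cat C)"
  by unfold_locales (auto simp: Hom_def)

end

lemma iso_arrow_op [simp]: "iso_arrow (op_cat C) f = iso_arrow C f"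
  by (auto simp: iso_arrow_def inverse_arrows_def)

section \<open>Functors, their opposites and natural transformations\<close>

lemma is_functorI:
  assumes "category C" "category D"
    and "\<And>A. A \<in> Obj C \<Longrightarrow> fob F A \<in> Obj D"
    and "\<And>f. f \<in> Arr C \<Longrightarrow> far F f \<in> Arr D \<and>
      Dom D (far F f) = fob F (Dom C f) \<and> Cod D (far F f) = fob F (Cod C f)"
    and "\<And>A. A \<in> Obj C \<Longrightarrow> far F (Ident C A) = Ident D (fob F A)"
    and "\<And>f g. f \<in> Arr C \<Longrightarrow> g \<in> Arr C \<Longrightarrow> Dom C g = Cod C f \<Longrightarrow>
      far F (g \<cdot>\<^bsub>C\<^esub> f) = far F g \<cdot>\<^bsub>D\<^esub> far F f"
  shows "is_functor C D F"
  using assms by (auto simp: is_functor_def is_functor_axioms_def Hom_def)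

context is_functor
begin

lemma fob_simp [simp]: "A \<in> Obj C \<Longrightarrow> fob F A \<in> Obj D"
  by (fact fob_Obj)

lemma far_simps [simp]:
  assumes "f \<in> Arr C"
  shows "far F f \<in> Arr D" "Dom D (far F f) = fob F (Dom C f)" "Cod D (far F f) = fob F (Cod C f)"
  using far_Hom [of f "Dom C f" "Cod C f"] assms by (simp_all add: Hom_def)

lemma far_Ident_simp [simp]: "A \<in> Obj C \<Longrightarrow> far F (Ident C A) = Ident D (fob F A)"
  by (fact far_Ident)

lemma far_Comp_simp [simp]:
  "f \<in> Arr C \<Longrightarrow> g \<in> Arr C \<Longrightarrow> Dom C g = Cod C f \<Longrightarrow>
    far F (g \<cdot>\<^bsub>C\<^esub> f) = far F g \<cdot>\<^bsub>D\<^esub> far F f"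
  by (rule far_Comp) (simp_all add: Hom_def)

lemma far_iso [simp]:
  assumes "iso_arrow C f"
  shows "iso_arrow D (far F f)"
proof (rule target.iso_arrowI)
  show "far F (inv_arrow C f) \<cdot>\<^bsub>D\<^esub> far F f = Ident D (Dom D (far F f))"
       "far F f \<cdot>\<^bsub>D\<^esub> far F (inv_arrow C f) = Ident D (Cod D (far F f))"
    using assms by (simp_all add: source.iso_Arr flip: far_Comp_simp)
qed (use assms in \<open>simp_all add: source.iso_Arr\<close>)

lemma functor_op: "is_functor (op_cat C) (op_cat D) F"
  by (intro is_functorI source.category_op target.category_op) simp_all

end

lemma functor_comp:
  assumes "is_functor C D F" "is_functor D E G"
  shows "is_functor C E (G \<circ>\<^sub>F F)"
proof -
  interpret F: is_functor C D F by fact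
  interpret G: is_functor D E G by fact
  show ?thesis
    by (rule is_functorI) (simp_all add: F.source.category_axioms G.target.category_axioms)
qed

lemma functor_id: "category C \<Longrightarrow> is_functor C C id_functor"
  by (rule is_functorI) simp_all

text \<open>Here, as in \<open>is_functorI\<close>, typing is expressed through \<open>Arr\<close>,
  \<open>Dom\<close> and \<open>Cod\<close> instead of \<open>Hom\<close>: these are equations that
  the simplifier computes, whereas membership in \<open>Hom\<close> would require guessing
  intermediate objects.\<close>

lemma natural_transformationI:
  assumes "is_functor C D F" "is_functor C D G"
    and "\<And>A. A \<in> Obj C \<Longrightarrow> \<eta> A \<in> Arr D \<and> Dom D (\<eta> A) = fob F A \<and> Cod D (\<eta> A) = fob G A"
    and "\<And>f. f \<in> Arr C \<Longrightarrow> far G f \<cdot>\<^bsub>D\<^esub> \<eta> (Dom C f) = \<eta> (Cod C f) \<cdot>\<^bsub>D\<^esub> far F f"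
  shows "natural_transformation C D F G \<eta>"
  using assms by (auto simp: natural_transformation_def natural_transformation_axioms_def Hom_def)

context natural_transformation
begin

lemma component_simps:
  assumes "A \<in> Obj C"
  shows "\<eta> A \<in> Arr D" "Dom D (\<eta> A) = fob F A" "Cod D (\<eta> A) = fob G A"
  using component_Hom [OF assms] by (simp_all add: Hom_def)

lemma natural_simp: "f \<in> Arr C \<Longrightarrow> far G f \<cdot>\<^bsub>D\<^esub> \<eta> (Dom C f) = \<eta> (Cod C f) \<cdot>\<^bsub>D\<^esub> far F f"
  by (rule natural) (simp add: Hom_def)

end

section \<open>Opposites and composites of additive and suspended structures\<close>

lemma hom_group_op [simp]: "hom_group (op_cat C) (op_susp S) A B = hom_group C S B A"
  by (simp add: hom_group_def)

lemma zero_object_op [simp]: "zero_object (op_cat C) Z = zero_object C Z"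
  by (auto simp: zero_object_def)

lemma (in additive_category) additive_op: "additive_category (op_cat C) (op_susp S)"
proof -
  interpret op: category "op_cat C" by (rule category_op)
  show ?thesis
  proof (intro additive_category.intro additive_category_axioms.intro op.category_axioms)
    fix A B assume AB: "A \<in> Obj (op_cat C)" "B \<in> Obj (op_cat C)"
    then obtain P i j p q where "P \<in> Obj C" "i \<in> Hom C A P" "j \<in> Hom C B P" "p \<in> Hom C P A"
      "q \<in> Hom C P B" "p \<cdot>\<^bsub>C\<^esub> i = Ident C A" "q \<cdot>\<^bsub>C\<^esub> j = Ident C B"
      "p \<cdot>\<^bsub>C\<^esub> j = Zero S B A" "q \<cdot>\<^bsub>C\<^esub> i = Zero S A B"
      "Add S (i \<cdot>\<^bsub>C\<^esub> p) (j \<cdot>\<^bsub>C\<^esub> q) = Ident C P"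
      using biproduct_exists [of A B] by auto
    then show "\<exists>P\<in>Obj (op_cat C). \<exists>i\<in>Hom (op_cat C) A P. \<exists>j\<in>Hom (op_cat C) B P.
      \<exists>p\<in>Hom (op_cat C) P A. \<exists>q\<in>Hom (op_cat C) P B.
        p \<cdot>\<^bsub>op_cat C\<^esub> i = Ident (op_cat C) A \<and> q \<cdot>\<^bsub>op_cat C\<^esub> j = Ident (op_cat C) B \<and>
        p \<cdot>\<^bsub>op_cat C\<^esub> j = Zero (op_susp S) B A \<and> q \<cdot>\<^bsub>op_cat C\<^esub> i = Zero (op_susp S) A B \<and>
        Add (op_susp S) (i \<cdot>\<^bsub>op_cat C\<^esub> p) (j \<cdot>\<^bsub>op_cat C\<^esub> q) = Ident (op_cat C) P"
      \<comment> \<open>Biproducts are self-dual: in the opposite category the projections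
        \<open>p\<close>, \<open>q\<close> serve as injections and the injections \<open>i\<close>,
        \<open>j\<close> as projections.\<close>
      by (intro bexI [of _ P] bexI [of _ p] bexI [of _ q] bexI [of _ i] bexI [of _ j]) auto
  qed (use hom_comm_group zero_object_exists Comp_Add_left Comp_Add_right in auto)
qed

context suspended_category
begin

lemma susp_desusp_simps [simp]:
  "A \<in> Obj C \<Longrightarrow> fob (Susp S) (fob (Desusp S) A) = A"
  "A \<in> Obj C \<Longrightarrow> fob (Desusp S) (fob (Susp S) A) = A"
  "f \<in> Arr C \<Longrightarrow> far (Susp S) (far (Desusp S) f) = f"
  "f \<in> Arr C \<Longrightarrow> far (Desusp S) (far (Susp S) f) = f"
  by (fact Susp_Desusp_ob Desusp_Susp_ob Susp_Desusp_ar Desusp_Susp_ar)+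

lemma suspended_op: "suspended_category (op_cat C) (op_susp S)"
proof -
  interpret op: additive_category "op_cat C" "op_susp S" by (rule additive_op)
  interpret opT: is_functor "op_cat C" "op_cat C" "Susp S" by (rule susp.functor_op)
  interpret opT': is_functor "op_cat C" "op_cat C" "Desusp S" by (rule desusp.functor_op)
  have "is_functor (op_cat C) (op_cat C) (Susp (op_susp S))"
    "is_functor (op_cat C) (op_cat C) (Desusp (op_susp S))"
    by (simp_all add: opT.is_functor_axioms opT'.is_functor_axioms)
  then show ?thesis
    by (intro suspended_category.intro op.additive_category_axioms suspended_category_axioms.intro) simp_all
qed

end

lemma suspended_functorI:
  assumes "suspended_category C S" "suspended_category D R" "is_functor C D F"
    and "\<And>A. A \<in> Obj C \<Longrightarrow> \<phi> A \<in> Arr D \<and> Dom D (\<phi> A) = fob F (fob (Susp S) A) \<and>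
      Cod D (\<phi> A) = fob (Susp R) (fob F A) \<and> iso_arrow D (\<phi> A)"
    and "\<And>f. f \<in> Arr C \<Longrightarrow>
      far (Susp R) (far F f) \<cdot>\<^bsub>D\<^esub> \<phi> (Dom C f) = \<phi> (Cod C f) \<cdot>\<^bsub>D\<^esub> far F (far (Susp S) f)"
  shows "suspended_functor C S D R F \<phi>"
proof -
  interpret C: suspended_category C S by fact
  interpret D: suspended_category D R by fact
  interpret F: is_functor C D F by fact
  have "natural_transformation C D (F \<circ>\<^sub>F Susp S) (Susp R \<circ>\<^sub>F F) \<phi>"
    using assms(4,5) by (intro natural_transformationI functor_comp [of _ C] functor_comp [of _ D]
        F.is_functor_axioms C.susp.is_functor_axioms D.susp.is_functor_axioms) simp_all
  then show ?thesis
    by (intro suspended_functor.intro assms(1-3) natural_isomorphism.intro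
        natural_isomorphism_axioms.intro) (simp_all add: assms(4))
qed

context suspended_functor
begin

lemma susp_iso_simps [simp]:
  assumes "A \<in> Obj C"
  shows "\<phi> A \<in> Arr D" "Dom D (\<phi> A) = fob F (fob (Susp S) A)" "Cod D (\<phi> A) = fob (Susp R) (fob F A)"
    "iso_arrow D (\<phi> A)"
  using component_simps [OF assms] component_iso [OF assms] by simp_all

lemma susp_iso_natural:
  "f \<in> Arr C \<Longrightarrow>
    far (Susp R) (far F f) \<cdot>\<^bsub>D\<^esub> \<phi> (Dom C f) = \<phi> (Cod C f) \<cdot>\<^bsub>D\<^esub> far F (far (Susp S) f)"
  using natural_simp by simp

text \<open>The component of \<open>op_susp_iso\<close> at \<open>A\<close> is the desuspension of
  \<open>\<phi>\<close> at \<open>T\<inverse>A\<close>. Hence its naturality at \<open>f\<close> is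
  that of \<open>\<phi>\<close> at \<open>T\<inverse>f\<close>, desuspended and read
  backwards.\<close>

lemma suspended_functor_op:
  "suspended_functor (op_cat C) (op_susp S) (op_cat D) (op_susp R) F (op_susp_iso S R \<phi>)"
proof (rule suspended_functorI)
  fix f assume f: "f \<in> Arr (op_cat C)"
  then have "far (Susp R) (far F (far (Desusp S) f)) \<cdot>\<^bsub>D\<^esub> \<phi> (fob (Desusp S) (Dom C f)) =
    \<phi> (fob (Desusp S) (Cod C f)) \<cdot>\<^bsub>D\<^esub> far F f"
    using susp_iso_natural [of "far (Desusp S) f"] by simp
  from arg_cong [OF this, of "far (Desusp R)"] f
  show "far (Susp (op_susp R)) (far F f) \<cdot>\<^bsub>op_cat D\<^esub> op_susp_iso S R \<phi> (Dom (op_cat C) f) =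
    op_susp_iso S R \<phi> (Cod (op_cat C) f) \<cdot>\<^bsub>op_cat D\<^esub> far F (far (Susp (op_susp S)) f)"
    by (simp add: op_susp_iso_def)
qed (simp_all add: source.suspended_op target.suspended_op functor_op op_susp_iso_def)

end

text \<open>Two squares are pasted: that of \<open>\<psi>\<close> at the arrow
  \<open>far F f\<close>, and the image under \<open>G\<close> of that of \<open>\<phi>\<close> at
  \<open>f\<close>.\<close>

lemma suspended_functor_comp:
  assumes "suspended_functor C S D R F \<phi>" "suspended_functor D R E Q G \<psi>"
  shows "suspended_functor C S E Q (G \<circ>\<^sub>F F) (comp_susp_iso E G \<psi> F \<phi>)"
proof -
  interpret F: suspended_functor C S D R F \<phi> by fact
  interpret G: suspended_functor D R E Q G \<psi> by fact
  show ?thesis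
  proof (rule suspended_functorI)
    fix f assume f: "f \<in> Arr C"
    have "far (Susp Q) (far G (far F f)) \<cdot>\<^bsub>E\<^esub> \<psi> (fob F (Dom C f)) \<cdot>\<^bsub>E\<^esub> far G (\<phi> (Dom C f))
      = (far (Susp Q) (far G (far F f)) \<cdot>\<^bsub>E\<^esub> \<psi> (fob F (Dom C f))) \<cdot>\<^bsub>E\<^esub> far G (\<phi> (Dom C f))"
      using f by simp
    also have "\<dots> = \<psi> (fob F (Cod C f)) \<cdot>\<^bsub>E\<^esub> far G (far (Susp R) (far F f) \<cdot>\<^bsub>D\<^esub> \<phi> (Dom C f))"
      using f G.susp_iso_natural [of "far F f"] by simp
    also have "\<dots> = \<psi> (fob F (Cod C f)) \<cdot>\<^bsub>E\<^esub> far G (\<phi> (Cod C f) \<cdot>\<^bsub>D\<^esub> far F (far (Susp S) f))"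
      using f by (simp only: F.susp_iso_natural)
    finally show "far (Susp Q) (far (G \<circ>\<^sub>F F) f) \<cdot>\<^bsub>E\<^esub> comp_susp_iso E G \<psi> F \<phi> (Dom C f) =
        comp_susp_iso E G \<psi> F \<phi> (Cod C f) \<cdot>\<^bsub>E\<^esub> far (G \<circ>\<^sub>F F) (far (Susp S) f)"
      using f by (simp add: comp_susp_iso_def)
  qed (simp_all add: F.source.suspended_category_axioms G.target.suspended_category_axioms
      functor_comp [OF F.is_functor_axioms G.is_functor_axioms] comp_susp_iso_def)
qed

lemma (in suspended_category) suspended_functor_id: "suspended_functor C S C S id_functor (id_susp_iso C S)"
  by (rule suspended_functorI)
    (simp_all add: suspended_category_axioms functor_id category_axioms id_susp_iso_def)

section \<open>Transposition and duality\<close>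

context symmetric_monoidal_category
begin

lemma Ident_tensor [simp]:
  "A \<in> Obj C \<Longrightarrow> B \<in> Obj C \<Longrightarrow> Ident C A \<star>\<^bsub>M\<^esub> Ident C B = Ident C (A \<boxtimes>\<^bsub>M\<^esub> B)"
  using tensor.far_Ident [of "(A, B)"] by simp

lemma tensor_Comp [simp]:
  assumes "f \<in> Arr C" "g \<in> Arr C" "Dom C g = Cod C f"
    and "f' \<in> Arr C" "g' \<in> Arr C" "Dom C g' = Cod C f'"
  shows "(g \<star>\<^bsub>M\<^esub> g') \<cdot>\<^bsub>C\<^esub> (f \<star>\<^bsub>M\<^esub> f') = (g \<cdot>\<^bsub>C\<^esub> f) \<star>\<^bsub>M\<^esub> (g' \<cdot>\<^bsub>C\<^esub> f')"
  using tensor.far_Comp_simp [of "(f, f')" "(g, g')"] assms by simp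

lemma tensor_Comp_Comp [simp]:
  assumes "f \<in> Arr C" "g \<in> Arr C" "Dom C g = Cod C f"
    and "f' \<in> Arr C" "g' \<in> Arr C" "Dom C g' = Cod C f'"
    and "h \<in> Arr C" "Cod C h = Dom C f \<boxtimes>\<^bsub>M\<^esub> Dom C f'"
  shows "(g \<star>\<^bsub>M\<^esub> g') \<cdot>\<^bsub>C\<^esub> (f \<star>\<^bsub>M\<^esub> f') \<cdot>\<^bsub>C\<^esub> h = ((g \<cdot>\<^bsub>C\<^esub> f) \<star>\<^bsub>M\<^esub> (g' \<cdot>\<^bsub>C\<^esub> f')) \<cdot>\<^bsub>C\<^esub> h"
  by (rule Comp_rewrite) (simp_all add: assms)

lemma symm_simps [simp]:
  assumes "A \<in> Obj C" "B \<in> Obj C"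
  shows "symm M A B \<in> Arr C" "Dom C (symm M A B) = A \<boxtimes>\<^bsub>M\<^esub> B" "Cod C (symm M A B) = B \<boxtimes>\<^bsub>M\<^esub> A"
proof -
  interpret symm: natural_isomorphism "prod_cat C C" C "tensor M"
      "tensor M \<circ>\<^sub>F \<lparr>fob = prod.swap, far = prod.swap\<rparr>" "\<lambda>(A, B). symm M A B"
    by (rule symm_iso)
  show "symm M A B \<in> Arr C" "Dom C (symm M A B) = A \<boxtimes>\<^bsub>M\<^esub> B" "Cod C (symm M A B) = B \<boxtimes>\<^bsub>M\<^esub> A"
    using symm.component_simps [of "(A, B)"] assms by simp_all
qed

lemma symm_natural:
  assumes "f \<in> Arr C" "g \<in> Arr C" "Cod C f = A" "Cod C g = B"
  shows "symm M A B \<cdot>\<^bsub>C\<^esub> (f \<star>\<^bsub>M\<^esub> g) = (g \<star>\<^bsub>M\<^esub> f) \<cdot>\<^bsub>C\<^esub> symm M (Dom C f) (Dom C g)"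
proof -
  interpret symm: natural_isomorphism "prod_cat C C" C "tensor M"
      "tensor M \<circ>\<^sub>F \<lparr>fob = prod.swap, far = prod.swap\<rparr>" "\<lambda>(A, B). symm M A B"
    by (rule symm_iso)
  show ?thesis
    using symm.natural_simp [of "(f, g)"] assms by simp
qed

end

section \<open>Evaluation, transposition and the biduality morphism\<close>

context symmetric_monoidal_closed_category
begin

lemma Ident_ihom [simp]:
  "A \<in> Obj C \<Longrightarrow> B \<in> Obj C \<Longrightarrow> ihom_ar M (Ident C A) (Ident C B) = Ident C (ihom_ob M A B)"
  using ihom.far_Ident [of "(A, B)"] by simp

lemma ihom_Comp [simp]:
  assumes "f \<in> Arr C" "g \<in> Arr C" "Dom C f = Cod C g"
    and "f' \<in> Arr C" "g' \<in> Arr C" "Dom C g' = Cod C f'"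
  shows "ihom_ar M g g' \<cdot>\<^bsub>C\<^esub> ihom_ar M f f' = ihom_ar M (f \<cdot>\<^bsub>C\<^esub> g) (g' \<cdot>\<^bsub>C\<^esub> f')"
  using ihom.far_Comp_simp [of "(f, f')" "(g, g')"] assms by simp

lemma ihom_Comp_Comp [simp]:
  assumes "f \<in> Arr C" "g \<in> Arr C" "Dom C f = Cod C g"
    and "f' \<in> Arr C" "g' \<in> Arr C" "Dom C g' = Cod C f'"
    and "h \<in> Arr C" "Cod C h = ihom_ob M (Cod C f) (Dom C f')"
  shows "ihom_ar M g g' \<cdot>\<^bsub>C\<^esub> ihom_ar M f f' \<cdot>\<^bsub>C\<^esub> h = ihom_ar M (f \<cdot>\<^bsub>C\<^esub> g) (g' \<cdot>\<^bsub>C\<^esub> f') \<cdot>\<^bsub>C\<^esub> h"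
  by (rule Comp_rewrite) (simp_all add: assms)

lemma ev_simps [simp]:
  assumes "X \<in> Obj C" "A \<in> Obj C"
  shows "ev M X A \<in> Arr C" "Dom C (ev M X A) = ihom_ob M X A \<boxtimes>\<^bsub>M\<^esub> X" "Cod C (ev M X A) = A"
proof -
  interpret adjunction C C "fix_snd C (tensor M) X" "fix_fst C (ihom M) X" "coev M X" "ev M X"
    by (rule closed) fact
  show "ev M X A \<in> Arr C" "Dom C (ev M X A) = ihom_ob M X A \<boxtimes>\<^bsub>M\<^esub> X" "Cod C (ev M X A) = A"
    using counit.component_simps [OF assms(2)] by simp_all
qed

lemma coev_simps [simp]:
  assumes "X \<in> Obj C" "A \<in> Obj C"
  shows "coev M X A \<in> Arr C" "Dom C (coev M X A) = A" "Cod C (coev M X A) = ihom_ob M X (A \<boxtimes>\<^bsub>M\<^esub> X)"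
proof -
  interpret adjunction C C "fix_snd C (tensor M) X" "fix_fst C (ihom M) X" "coev M X" "ev M X"
    by (rule closed) fact
  show "coev M X A \<in> Arr C" "Dom C (coev M X A) = A" "Cod C (coev M X A) = ihom_ob M X (A \<boxtimes>\<^bsub>M\<^esub> X)"
    using unit.component_simps [OF assms(2)] by simp_all
qed

text \<open>Naturality of the counit \<open>ev M X\<close>. The extra factors \<open>g\<close> and
  \<open>h\<close> are there because \<open>tensor_Comp\<close> merges adjacent tensor products of
  arrows, so the bare naturality square would seldom match; the other evaluation rules below carry
  such factors for the same reason.\<close>

lemma ev_post:
  assumes "X \<in> Obj C" "f \<in> Arr C" "Cod C f = B" "g \<in> Arr C" "Cod C g = ihom_ob M X (Dom C f)"
    "h \<in> Arr C" "Cod C h = X"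
  shows "ev M X B \<cdot>\<^bsub>C\<^esub> ((ihom_ar M (Ident C X) f \<cdot>\<^bsub>C\<^esub> g) \<star>\<^bsub>M\<^esub> h)
    = f \<cdot>\<^bsub>C\<^esub> ev M X (Dom C f) \<cdot>\<^bsub>C\<^esub> (g \<star>\<^bsub>M\<^esub> h)"
proof -
  interpret adjunction C C "fix_snd C (tensor M) X" "fix_fst C (ihom M) X" "coev M X" "ev M X"
    by (rule closed) fact
  have nat: "ev M X B \<cdot>\<^bsub>C\<^esub> (ihom_ar M (Ident C X) f \<star>\<^bsub>M\<^esub> Ident C X) = f \<cdot>\<^bsub>C\<^esub> ev M X (Dom C f)"
    using counit.natural_simp [of f] assms by simp
  have "ev M X B \<cdot>\<^bsub>C\<^esub> ((ihom_ar M (Ident C X) f \<cdot>\<^bsub>C\<^esub> g) \<star>\<^bsub>M\<^esub> h)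
    = (ev M X B \<cdot>\<^bsub>C\<^esub> (ihom_ar M (Ident C X) f \<star>\<^bsub>M\<^esub> Ident C X)) \<cdot>\<^bsub>C\<^esub> (g \<star>\<^bsub>M\<^esub> h)"
    using assms by auto
  also have "\<dots> = f \<cdot>\<^bsub>C\<^esub> ev M X (Dom C f) \<cdot>\<^bsub>C\<^esub> (g \<star>\<^bsub>M\<^esub> h)"
    unfolding nat using assms by simp
  finally show ?thesis .
qed

lemma coev_natural:
  assumes "X \<in> Obj C" "f \<in> Arr C"
  shows "coev M X (Cod C f) \<cdot>\<^bsub>C\<^esub> f
    = ihom_ar M (Ident C X) (f \<star>\<^bsub>M\<^esub> Ident C X) \<cdot>\<^bsub>C\<^esub> coev M X (Dom C f)"
proof -
  interpret adjunction C C "fix_snd C (tensor M) X" "fix_fst C (ihom M) X" "coev M X" "ev M X"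
    by (rule closed) fact
  show ?thesis
    using unit.natural_simp [OF assms(2)] by simp
qed

text \<open>Extranaturality of the counit: an arrow acting contravariantly on the internal Hom may
  instead act on the argument at which one evaluates.\<close>

lemma ev_ihom:
  assumes "A \<in> Obj C" "f \<in> Arr C" "Dom C f = X" "g \<in> Arr C" "Cod C g = ihom_ob M (Cod C f) A"
    "h \<in> Arr C" "Cod C h = X"
  shows "ev M X A \<cdot>\<^bsub>C\<^esub> ((ihom_ar M f (Ident C A) \<cdot>\<^bsub>C\<^esub> g) \<star>\<^bsub>M\<^esub> h)
    = ev M (Cod C f) A \<cdot>\<^bsub>C\<^esub> (g \<star>\<^bsub>M\<^esub> (f \<cdot>\<^bsub>C\<^esub> h))"
proof -
  have "ev M X A \<cdot>\<^bsub>C\<^esub> ((ihom_ar M f (Ident C A) \<cdot>\<^bsub>C\<^esub> g) \<star>\<^bsub>M\<^esub> h)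
    = (ev M X A \<cdot>\<^bsub>C\<^esub> (ihom_ar M f (Ident C A) \<star>\<^bsub>M\<^esub> Ident C X)) \<cdot>\<^bsub>C\<^esub> (g \<star>\<^bsub>M\<^esub> h)"
    using assms by auto
  also have "\<dots> = (ev M (Cod C f) A \<cdot>\<^bsub>C\<^esub> (Ident C (ihom_ob M (Cod C f) A) \<star>\<^bsub>M\<^esub> f)) \<cdot>\<^bsub>C\<^esub> (g \<star>\<^bsub>M\<^esub> h)"
    using ev_extranatural [of f X "Cod C f" A] assms by (simp add: Hom_def)
  also have "\<dots> = ev M (Cod C f) A \<cdot>\<^bsub>C\<^esub> (g \<star>\<^bsub>M\<^esub> (f \<cdot>\<^bsub>C\<^esub> h))"
    using assms by auto
  finally show ?thesis .
qed

lemma ev_ihom_Ident: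
  assumes "A \<in> Obj C" "f \<in> Arr C" "Dom C f = X" "h \<in> Arr C" "Cod C h = X"
  shows "ev M X A \<cdot>\<^bsub>C\<^esub> (ihom_ar M f (Ident C A) \<star>\<^bsub>M\<^esub> h)
    = ev M (Cod C f) A \<cdot>\<^bsub>C\<^esub> (Ident C (ihom_ob M (Cod C f) A) \<star>\<^bsub>M\<^esub> (f \<cdot>\<^bsub>C\<^esub> h))"
  using ev_ihom [of A f X "Ident C (ihom_ob M (Cod C f) A)" h] assms by simp

text \<open>The adjunct of \<open>f\<close> under
  \<open>(- \<otimes> X) \<stileturn> [X, -]\<close>. The object \<open>B\<close> is an explicit
  argument because it cannot be recovered from the domain \<open>B \<otimes> X\<close> of
  \<open>f\<close>.\<close>

definition transpose :: "'o \<Rightarrow> 'o \<Rightarrow> 'a \<Rightarrow> 'a" where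
  "transpose X B f = ihom_ar M (Ident C X) f \<cdot>\<^bsub>C\<^esub> coev M X B"

lemma transpose_simps [simp]:
  assumes "X \<in> Obj C" "B \<in> Obj C" "f \<in> Arr C" "Dom C f = B \<boxtimes>\<^bsub>M\<^esub> X"
  shows "transpose X B f \<in> Arr C" "Dom C (transpose X B f) = B"
    "Cod C (transpose X B f) = ihom_ob M X (Cod C f)"
  using assms by (simp_all add: transpose_def)

text \<open>By \<open>ev_post\<close> the arrow \<open>f\<close> leaves the evaluation, and what
  remains is the left triangle identity for \<open>coev\<close> and \<open>ev\<close>.\<close>

lemma ev_transpose:
  assumes "X \<in> Obj C" "B \<in> Obj C" "f \<in> Arr C" "Dom C f = B \<boxtimes>\<^bsub>M\<^esub> X" "Cod C f = A"
    "g \<in> Arr C" "Cod C g = B" "h \<in> Arr C" "Cod C h = X"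
  shows "ev M X A \<cdot>\<^bsub>C\<^esub> ((transpose X B f \<cdot>\<^bsub>C\<^esub> g) \<star>\<^bsub>M\<^esub> h) = f \<cdot>\<^bsub>C\<^esub> (g \<star>\<^bsub>M\<^esub> h)"
proof -
  interpret adjunction C C "fix_snd C (tensor M) X" "fix_fst C (ihom M) X" "coev M X" "ev M X"
    by (rule closed) fact
  have "ev M X (B \<boxtimes>\<^bsub>M\<^esub> X) \<cdot>\<^bsub>C\<^esub> ((coev M X B \<cdot>\<^bsub>C\<^esub> g) \<star>\<^bsub>M\<^esub> h)
    = (ev M X (B \<boxtimes>\<^bsub>M\<^esub> X) \<cdot>\<^bsub>C\<^esub> (coev M X B \<star>\<^bsub>M\<^esub> Ident C X)) \<cdot>\<^bsub>C\<^esub> (g \<star>\<^bsub>M\<^esub> h)"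
    using assms by auto
  also have "\<dots> = g \<star>\<^bsub>M\<^esub> h"
    using assms triangle_left [OF assms(2)] by simp
  finally have *: "ev M X (B \<boxtimes>\<^bsub>M\<^esub> X) \<cdot>\<^bsub>C\<^esub> ((coev M X B \<cdot>\<^bsub>C\<^esub> g) \<star>\<^bsub>M\<^esub> h) = g \<star>\<^bsub>M\<^esub> h" .
  show ?thesis
    unfolding transpose_def using assms by (simp add: ev_post *)
qed

lemma ev_transpose_Ident:
  assumes "X \<in> Obj C" "B \<in> Obj C" "f \<in> Arr C" "Dom C f = B \<boxtimes>\<^bsub>M\<^esub> X" "Cod C f = A"
    "h \<in> Arr C" "Cod C h = X"
  shows "ev M X A \<cdot>\<^bsub>C\<^esub> (transpose X B f \<star>\<^bsub>M\<^esub> h) = f \<cdot>\<^bsub>C\<^esub> (Ident C B \<star>\<^bsub>M\<^esub> h)"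
  using ev_transpose [of X B f A "Ident C B" h] assms by simp

text \<open>The right triangle identity, followed by naturality of \<open>coev\<close>. Together
  with \<open>ev_transpose\<close> this makes transposition a bijection.\<close>

lemma transpose_ev:
  assumes "X \<in> Obj C" "A \<in> Obj C" "f \<in> Arr C" "Cod C f = ihom_ob M X A"
  shows "transpose X (Dom C f) (ev M X A \<cdot>\<^bsub>C\<^esub> (f \<star>\<^bsub>M\<^esub> Ident C X)) = f"
proof -
  interpret adjunction C C "fix_snd C (tensor M) X" "fix_fst C (ihom M) X" "coev M X" "ev M X"
    by (rule closed) fact
  have "f = (ihom_ar M (Ident C X) (ev M X A) \<cdot>\<^bsub>C\<^esub> coev M X (ihom_ob M X A)) \<cdot>\<^bsub>C\<^esub> f"
    using assms triangle_right [OF assms(2)] by simp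
  also have "\<dots> = ihom_ar M (Ident C X) (ev M X A) \<cdot>\<^bsub>C\<^esub> coev M X (Cod C f) \<cdot>\<^bsub>C\<^esub> f"
    using assms by simp
  also have "\<dots> = transpose X (Dom C f) (ev M X A \<cdot>\<^bsub>C\<^esub> (f \<star>\<^bsub>M\<^esub> Ident C X))"
    unfolding coev_natural [OF assms(1,3)] using assms by (simp add: transpose_def)
  finally show ?thesis by simp
qed

text \<open>By \<open>transpose_ev\<close> each arrow is the transpose of its own evaluation, so
  equal evaluations come from equal arrows.\<close>

lemma ev_ext:
  assumes "X \<in> Obj C" "A \<in> Obj C" "f \<in> Arr C" "g \<in> Arr C" "Cod C f = ihom_ob M X A"
    "Cod C g = ihom_ob M X A" "Dom C f = Dom C g"
    and "ev M X A \<cdot>\<^bsub>C\<^esub> (f \<star>\<^bsub>M\<^esub> Ident C X) = ev M X A \<cdot>\<^bsub>C\<^esub> (g \<star>\<^bsub>M\<^esub> Ident C X)"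
  shows "f = g"
  using assms by (metis transpose_ev)

lemma bidual_transpose:
  "bidual C M K A = transpose (ihom_ob M A K) A (ev M A K \<cdot>\<^bsub>C\<^esub> symm M A (ihom_ob M A K))"
  by (simp add: bidual_def ev_right_def transpose_def)

lemma bidual_simps [simp]:
  assumes "K \<in> Obj C" "A \<in> Obj C"
  shows "bidual C M K A \<in> Arr C" "Dom C (bidual C M K A) = A"
    "Cod C (bidual C M K A) = ihom_ob M (ihom_ob M A K) K"
  using assms by (simp_all add: bidual_transpose)

text \<open>The biduality is the transpose of \<open>ev \<circ> s\<close>. Naturality of the
  symmetry then moves \<open>s\<close> to the far right, which exchanges \<open>g\<close> and
  \<open>h\<close>: an element evaluated at a functional is the functional evaluated at the
  element.\<close>

lemma ev_bidual:
  assumes "K \<in> Obj C" "A \<in> Obj C" "g \<in> Arr C" "Cod C g = A" "h \<in> Arr C" "Cod C h = ihom_ob M A K"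
  shows "ev M (ihom_ob M A K) K \<cdot>\<^bsub>C\<^esub> ((bidual C M K A \<cdot>\<^bsub>C\<^esub> g) \<star>\<^bsub>M\<^esub> h)
    = ev M A K \<cdot>\<^bsub>C\<^esub> (h \<star>\<^bsub>M\<^esub> g) \<cdot>\<^bsub>C\<^esub> symm M (Dom C g) (Dom C h)"
  using assms by (simp add: bidual_transpose ev_transpose symm_natural)

lemma ev_bidual_Ident:
  assumes "K \<in> Obj C" "A \<in> Obj C" "h \<in> Arr C" "Cod C h = ihom_ob M A K"
  shows "ev M (ihom_ob M A K) K \<cdot>\<^bsub>C\<^esub> (bidual C M K A \<star>\<^bsub>M\<^esub> h)
    = ev M A K \<cdot>\<^bsub>C\<^esub> (h \<star>\<^bsub>M\<^esub> Ident C A) \<cdot>\<^bsub>C\<^esub> symm M A (Dom C h)"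
  using ev_bidual [of K A "Ident C A" h] assms by simp

end

section \<open>The category with duality given by \<open>[-, K]\<close>\<close>

lemma dual_simps [simp]:
  "fob (dual C M K) A = ihom_ob M A K" "far (dual C M K) f = ihom_ar M f (Ident C K)"
  by (simp_all add: dual_def)

context symmetric_monoidal_closed_category
begin

lemma dual_functor:
  assumes "K \<in> Obj C"
  shows "is_functor (op_cat C) C (dual C M K)"
  by (rule is_functorI) (simp_all add: assms category_op category_axioms)

lemma dual_functor_op:
  assumes "K \<in> Obj C"
  shows "is_functor C (op_cat C) (dual C M K)"
  using is_functor.functor_op [OF dual_functor [OF assms]] by simp

lemma bidual_natural:
  assumes "K \<in> Obj C"
  shows "natural_transformation C C id_functor (dual C M K \<circ>\<^sub>F dual C M K) (bidual C M K)"
proof (rule natural_transformationI)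
  fix f assume f: "f \<in> Arr C"
  \<comment> \<open>Evaluated on \<open>[Y, K]\<close>, where \<open>Y\<close> is the codomain of
    \<open>f\<close>, both sides become \<open>ev M Y K\<close> after \<open>f\<close> in the second
    factor and the symmetry.\<close>
  have "ihom_ar M (ihom_ar M f (Ident C K)) (Ident C K) \<cdot>\<^bsub>C\<^esub> bidual C M K (Dom C f)
    = bidual C M K (Cod C f) \<cdot>\<^bsub>C\<^esub> f"
    by (rule ev_ext [of "ihom_ob M (Cod C f) K" K])
      (use f assms in \<open>simp_all add: ev_ihom ev_bidual ev_bidual_Ident
        Comp_rewrite [OF ev_ihom_Ident]\<close>)
  then show "far (dual C M K \<circ>\<^sub>F dual C M K) f \<cdot>\<^bsub>C\<^esub> bidual C M K (Dom C f)
      = bidual C M K (Cod C f) \<cdot>\<^bsub>C\<^esub> far id_functor f"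
    by simp
qed (simp_all add: assms functor_id category_axioms functor_comp [OF dual_functor_op dual_functor])

text \<open>Evaluating on \<open>A\<close> moves the inner biduality across the tensor product. Each
  of the two bidualities then contributes one symmetry, and the two symmetries cancel.\<close>

lemma dual_bidual:
  assumes "K \<in> Obj C" "A \<in> Obj C"
  shows "ihom_ar M (bidual C M K A) (Ident C K) \<cdot>\<^bsub>C\<^esub> bidual C M K (ihom_ob M A K)
    = Ident C (ihom_ob M A K)"
proof (rule ev_ext [of A K])
  have "ev M (ihom_ob M A K) K \<cdot>\<^bsub>C\<^esub> (bidual C M K A \<star>\<^bsub>M\<^esub> Ident C (ihom_ob M A K))
      \<cdot>\<^bsub>C\<^esub> symm M (ihom_ob M A K) A = ev M A K"
    using assms by (subst Comp_rewrite [OF ev_bidual_Ident]) (simp_all add: symm_symm)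
  then show "ev M A K \<cdot>\<^bsub>C\<^esub> ((ihom_ar M (bidual C M K A) (Ident C K)
        \<cdot>\<^bsub>C\<^esub> bidual C M K (ihom_ob M A K)) \<star>\<^bsub>M\<^esub> Ident C A)
      = ev M A K \<cdot>\<^bsub>C\<^esub> (Ident C (ihom_ob M A K) \<star>\<^bsub>M\<^esub> Ident C A)"
    using assms by (simp add: ev_ihom ev_bidual_Ident)
qed (simp_all add: assms)

text \<open>Unit and counit are the same family. In the opposite category the naturality square of
  the counit is that of the unit read backwards, and both triangle identities are
  \<open>dual_bidual\<close>.\<close>

lemma dual_category_with_duality:
  assumes "K \<in> Obj C"
  shows "category_with_duality C (dual C M K) (bidual C M K)"
proof -
  interpret unit: natural_transformation C C id_functor "dual C M K \<circ>\<^sub>F dual C M K" "bidual C M K"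
    by (rule bidual_natural) fact
  have counit: "natural_transformation (op_cat C) (op_cat C) (dual C M K \<circ>\<^sub>F dual C M K) id_functor
      (bidual C M K)"
    by (rule natural_transformationI)
      (use assms unit.natural_simp in \<open>simp_all add: functor_id category_op
        functor_comp [OF dual_functor dual_functor_op]\<close>)
  show ?thesis
    by (intro category_with_duality.intro adjunction.intro adjunction_axioms.intro
        unit.natural_transformation_axioms counit dual_functor dual_functor_op)
      (simp_all add: assms dual_bidual)
qed

end

section \<open>The morphism \<open>\<beta>\<close> of a symmetric monoidal functor between closed
  categories\<close>

locale symmetric_monoidal_closed_functor =
  source: symmetric_monoidal_closed_category C M +
  target: symmetric_monoidal_closed_category D N +
  symmetric_monoidal_functor C M D N F \<alpha> \<iota>
  for C :: "('o, 'a) cat" and M :: "('o, 'a) monoidal_closed"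
    and D :: "('p, 'b) cat" and N :: "('p, 'b) monoidal_closed"
    and F :: "('o, 'a, 'p, 'b) cfunctor" and \<alpha> :: "'o \<Rightarrow> 'o \<Rightarrow> 'b" and \<iota> :: "'b option"
begin

abbreviation \<beta> :: "'o \<Rightarrow> 'o \<Rightarrow> 'b" where
  "\<beta> A B \<equiv> beta M D N F \<alpha> A B"

lemma alpha_simps [simp]:
  assumes "A \<in> Obj C" "B \<in> Obj C"
  shows "\<alpha> A B \<in> Arr D" "Dom D (\<alpha> A B) = fob F A \<boxtimes>\<^bsub>N\<^esub> fob F B"
    "Cod D (\<alpha> A B) = fob F (A \<boxtimes>\<^bsub>M\<^esub> B)"
  using component_simps [of "(A, B)"] assms by simp_all

lemma alpha_natural:
  assumes "f \<in> Arr C" "g \<in> Arr C" "Cod C f = A" "Cod C g = B"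
  shows "\<alpha> A B \<cdot>\<^bsub>D\<^esub> (far F f \<star>\<^bsub>N\<^esub> far F g) = far F (f \<star>\<^bsub>M\<^esub> g) \<cdot>\<^bsub>D\<^esub> \<alpha> (Dom C f) (Dom C g)"
  using natural_simp [of "(f, g)"] assms by simp

lemma beta_transpose:
  assumes "A \<in> Obj C" "B \<in> Obj C"
  shows "\<beta> A B = target.transpose (fob F A) (fob F (ihom_ob M A B))
    (far F (ev M A B) \<cdot>\<^bsub>D\<^esub> \<alpha> (ihom_ob M A B) A)"
  using assms by (simp add: beta_def target.transpose_def)

lemma beta_simps [simp]:
  assumes "A \<in> Obj C" "B \<in> Obj C"
  shows "\<beta> A B \<in> Arr D" "Dom D (\<beta> A B) = fob F (ihom_ob M A B)"
    "Cod D (\<beta> A B) = ihom_ob N (fob F A) (fob F B)"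
  using assms by (simp_all add: beta_transpose)

lemma ev_beta:
  assumes "A \<in> Obj C" "B \<in> Obj C" "g \<in> Arr D" "Cod D g = fob F (ihom_ob M A B)"
    "h \<in> Arr D" "Cod D h = fob F A"
  shows "ev N (fob F A) (fob F B) \<cdot>\<^bsub>D\<^esub> ((\<beta> A B \<cdot>\<^bsub>D\<^esub> g) \<star>\<^bsub>N\<^esub> h)
    = far F (ev M A B) \<cdot>\<^bsub>D\<^esub> \<alpha> (ihom_ob M A B) A \<cdot>\<^bsub>D\<^esub> (g \<star>\<^bsub>N\<^esub> h)"
  using assms by (simp add: beta_transpose target.ev_transpose)

lemma ev_beta_Ident:
  assumes "A \<in> Obj C" "B \<in> Obj C" "h \<in> Arr D" "Cod D h = fob F A"
  shows "ev N (fob F A) (fob F B) \<cdot>\<^bsub>D\<^esub> (\<beta> A B \<star>\<^bsub>N\<^esub> h)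
    = far F (ev M A B) \<cdot>\<^bsub>D\<^esub> \<alpha> (ihom_ob M A B) A \<cdot>\<^bsub>D\<^esub> (Ident D (fob F (ihom_ob M A B)) \<star>\<^bsub>N\<^esub> h)"
  using ev_beta [of A B "Ident D (fob F (ihom_ob M A B))" h] assms by simp

text \<open>After evaluation the two sides are the images under \<open>F\<close> of the two sides of
  the extranaturality of \<open>ev M\<close> at \<open>f\<close>, each preceded by the same
  component of \<open>\<alpha>\<close>.\<close>

lemma beta_natural:
  assumes "K \<in> Obj C" "f \<in> Arr C"
  shows "ihom_ar N (far F f) (Ident D (fob F K)) \<cdot>\<^bsub>D\<^esub> \<beta> (Cod C f) K
    = \<beta> (Dom C f) K \<cdot>\<^bsub>D\<^esub> far F (ihom_ar M f (Ident C K))"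
proof (rule target.ev_ext [of "fob F (Dom C f)" "fob F K"])
  let ?X = "Dom C f" and ?Y = "Cod C f"
  have "ev N (fob F ?X) (fob F K) \<cdot>\<^bsub>D\<^esub> ((ihom_ar N (far F f) (Ident D (fob F K)) \<cdot>\<^bsub>D\<^esub> \<beta> ?Y K)
      \<star>\<^bsub>N\<^esub> Ident D (fob F ?X))
    = far F (ev M ?Y K) \<cdot>\<^bsub>D\<^esub> \<alpha> (ihom_ob M ?Y K) ?Y
      \<cdot>\<^bsub>D\<^esub> (far F (Ident C (ihom_ob M ?Y K)) \<star>\<^bsub>N\<^esub> far F f)"
    using assms by (simp add: target.ev_ihom ev_beta_Ident)
  \<comment> \<open>\<open>alpha_natural\<close> matches only arrows of the form
    \<open>far F f\<close>. The identity must therefore stay an image under \<open>F\<close>, which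
    is why \<open>far_Ident_simp\<close> is switched off.\<close>
  also have "\<dots> = far F (ev M ?Y K \<cdot>\<^bsub>C\<^esub> (Ident C (ihom_ob M ?Y K) \<star>\<^bsub>M\<^esub> f))
      \<cdot>\<^bsub>D\<^esub> \<alpha> (ihom_ob M ?Y K) ?X"
    using assms by (simp add: alpha_natural del: far_Ident_simp)
  also have "\<dots> = far F (ev M ?X K \<cdot>\<^bsub>C\<^esub> (ihom_ar M f (Ident C K) \<star>\<^bsub>M\<^esub> Ident C ?X))
      \<cdot>\<^bsub>D\<^esub> \<alpha> (ihom_ob M ?Y K) ?X"
    using assms source.ev_ihom_Ident [of K f ?X "Ident C ?X"] by simp
  also have "\<dots> = ev N (fob F ?X) (fob F K) \<cdot>\<^bsub>D\<^esub>
      ((\<beta> ?X K \<cdot>\<^bsub>D\<^esub> far F (ihom_ar M f (Ident C K))) \<star>\<^bsub>N\<^esub> far F (Ident C ?X))"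
    using assms by (simp add: ev_beta alpha_natural del: far_Ident_simp)
  finally show "ev N (fob F ?X) (fob F K) \<cdot>\<^bsub>D\<^esub> ((ihom_ar N (far F f) (Ident D (fob F K)) \<cdot>\<^bsub>D\<^esub> \<beta> ?Y K)
      \<star>\<^bsub>N\<^esub> Ident D (fob F ?X)) = ev N (fob F ?X) (fob F K) \<cdot>\<^bsub>D\<^esub>
      ((\<beta> ?X K \<cdot>\<^bsub>D\<^esub> far F (ihom_ar M f (Ident C K))) \<star>\<^bsub>N\<^esub> Ident D (fob F ?X))"
    using assms by simp
qed (simp_all add: assms)

text \<open>The left side evaluates to \<open>F(ev \<circ> s) \<circ> \<alpha>\<close>, the right
  side to \<open>F(ev) \<circ> \<alpha> \<circ> s\<close>. Compatibility of \<open>\<alpha>\<close>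
  with the symmetries identifies them.\<close>

lemma beta_bidual:
  assumes "K \<in> Obj C" "A \<in> Obj C"
  shows "\<beta> (ihom_ob M A K) K \<cdot>\<^bsub>D\<^esub> far F (bidual C M K A)
    = ihom_ar N (\<beta> A K) (Ident D (fob F K)) \<cdot>\<^bsub>D\<^esub> bidual D N (fob F K) (fob F A)"
proof (rule target.ev_ext [of "fob F (ihom_ob M A K)" "fob F K"])
  let ?H = "ihom_ob M A K"
  have "ev N (fob F ?H) (fob F K) \<cdot>\<^bsub>D\<^esub> ((\<beta> ?H K \<cdot>\<^bsub>D\<^esub> far F (bidual C M K A))
      \<star>\<^bsub>N\<^esub> Ident D (fob F ?H))
    = far F (ev M ?H K) \<cdot>\<^bsub>D\<^esub> \<alpha> (ihom_ob M ?H K) ?H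
      \<cdot>\<^bsub>D\<^esub> (far F (bidual C M K A) \<star>\<^bsub>N\<^esub> far F (Ident C ?H))"
    using assms by (simp add: ev_beta)
  also have "\<dots> = far F (ev M ?H K \<cdot>\<^bsub>C\<^esub> (bidual C M K A \<star>\<^bsub>M\<^esub> Ident C ?H)) \<cdot>\<^bsub>D\<^esub> \<alpha> A ?H"
    using assms by (simp add: alpha_natural del: far_Ident_simp)
  also have "\<dots> = far F (ev M A K) \<cdot>\<^bsub>D\<^esub> far F (symm M A ?H) \<cdot>\<^bsub>D\<^esub> \<alpha> A ?H"
    using assms by (simp add: source.ev_bidual_Ident)
  also have "\<dots> = far F (ev M A K) \<cdot>\<^bsub>D\<^esub> \<alpha> ?H A \<cdot>\<^bsub>D\<^esub> symm N (fob F A) (fob F ?H)"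
    using assms by (simp add: \<alpha>_symm)
  \<comment> \<open>The evaluation of \<open>\<beta>\<close> is reintroduced as a bracketed pair;
    associativity is applied only after \<open>ev_beta_Ident\<close> has matched that pair.\<close>
  also have "\<dots> = (ev N (fob F A) (fob F K) \<cdot>\<^bsub>D\<^esub> (\<beta> A K \<star>\<^bsub>N\<^esub> Ident D (fob F A)))
      \<cdot>\<^bsub>D\<^esub> symm N (fob F A) (fob F ?H)"
    using assms by (simp add: ev_beta_Ident del: target.Comp_assoc_simp) simp
  also have "\<dots> = ev N (fob F ?H) (fob F K) \<cdot>\<^bsub>D\<^esub> ((ihom_ar N (\<beta> A K) (Ident D (fob F K))
      \<cdot>\<^bsub>D\<^esub> bidual D N (fob F K) (fob F A)) \<star>\<^bsub>N\<^esub> Ident D (fob F ?H))"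
    using assms by (simp add: target.ev_ihom target.ev_bidual_Ident)
  finally show "ev N (fob F ?H) (fob F K) \<cdot>\<^bsub>D\<^esub> ((\<beta> ?H K \<cdot>\<^bsub>D\<^esub> far F (bidual C M K A))
      \<star>\<^bsub>N\<^esub> Ident D (fob F ?H)) = ev N (fob F ?H) (fob F K) \<cdot>\<^bsub>D\<^esub> ((ihom_ar N (\<beta> A K) (Ident D (fob F K))
      \<cdot>\<^bsub>D\<^esub> bidual D N (fob F K) (fob F A)) \<star>\<^bsub>N\<^esub> Ident D (fob F ?H))" .
qed (simp_all add: assms)

lemma beta_duality_preserving:
  assumes "K \<in> Obj C"
  shows "duality_preserving_functor C (dual C M K) (bidual C M K)
    D (dual D N (fob F K)) (bidual D N (fob F K)) F (\<lambda>A. \<beta> A K)"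
proof -
  have "natural_transformation (op_cat C) D (F \<circ>\<^sub>F dual C M K) (dual D N (fob F K) \<circ>\<^sub>F F) (\<lambda>A. \<beta> A K)"
    by (rule natural_transformationI)
      (simp_all add: assms functor_comp [OF source.dual_functor is_functor_axioms]
        functor_comp [OF functor_op target.dual_functor] beta_natural)
  then show ?thesis
    by (intro duality_preserving_functor.intro duality_preserving_functor_axioms.intro
        source.dual_category_with_duality target.dual_category_with_duality is_functor_axioms)
      (simp_all add: assms beta_bidual)
qed

end

section \<open>Suspended and triangulated dualities\<close>

text \<open>\<open>th1\<close> is characterised through its desuspension. Equations of arrows into a
  suspended internal Hom are therefore desuspended first, so that \<open>ev_ext\<close>
  applies.\<close>

lemma (in suspended_category) susp_cancel:
  "f \<in> Arr C \<Longrightarrow> g \<in> Arr C \<Longrightarrow> far (Desusp S) f = far (Desusp S) g \<Longrightarrow> f = g"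
  by (metis Susp_Desusp_ar)

section \<open>The shift isomorphism and the suspended structure of the duality\<close>

context suspended_symmetric_monoidal_closed_category
begin

lemma tp_simps [simp]:
  assumes "X \<in> Obj C" "Y \<in> Obj C"
  shows "tp1 X Y \<in> Arr C" "Dom C (tp1 X Y) = fob (Susp S) X \<boxtimes>\<^bsub>M\<^esub> Y"
    "Cod C (tp1 X Y) = fob (Susp S) (X \<boxtimes>\<^bsub>M\<^esub> Y)" "iso_arrow C (tp1 X Y)"
    "tp2 X Y \<in> Arr C" "Dom C (tp2 X Y) = X \<boxtimes>\<^bsub>M\<^esub> fob (Susp S) Y"
    "Cod C (tp2 X Y) = fob (Susp S) (X \<boxtimes>\<^bsub>M\<^esub> Y)" "iso_arrow C (tp2 X Y)"
  using b1.component_simps [of "(X, Y)"] b1.component_iso [of "(X, Y)"]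
    b2.component_simps [of "(X, Y)"] b2.component_iso [of "(X, Y)"] assms by simp_all

lemma tp_natural:
  assumes "f \<in> Arr C" "g \<in> Arr C"
  shows "far (Susp S) (f \<star>\<^bsub>M\<^esub> g) \<cdot>\<^bsub>C\<^esub> tp1 (Dom C f) (Dom C g)
      = tp1 (Cod C f) (Cod C g) \<cdot>\<^bsub>C\<^esub> (far (Susp S) f \<star>\<^bsub>M\<^esub> g)"
    "far (Susp S) (f \<star>\<^bsub>M\<^esub> g) \<cdot>\<^bsub>C\<^esub> tp2 (Dom C f) (Dom C g)
      = tp2 (Cod C f) (Cod C g) \<cdot>\<^bsub>C\<^esub> (f \<star>\<^bsub>M\<^esub> far (Susp S) g)"
  using b1.natural_simp [of "(f, g)"] b2.natural_simp [of "(f, g)"] assms by simp_all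

definition susp_shift :: "'o \<Rightarrow> 'o \<Rightarrow> 'a" where
  "susp_shift X Y = inv_arrow C (tp1 X Y) \<cdot>\<^bsub>C\<^esub> tp2 X Y"

lemma susp_shift_simps [simp]:
  assumes "X \<in> Obj C" "Y \<in> Obj C"
  shows "susp_shift X Y \<in> Arr C" "Dom C (susp_shift X Y) = X \<boxtimes>\<^bsub>M\<^esub> fob (Susp S) Y"
    "Cod C (susp_shift X Y) = fob (Susp S) X \<boxtimes>\<^bsub>M\<^esub> Y" "iso_arrow C (susp_shift X Y)"
  using assms by (simp_all add: susp_shift_def)

text \<open>Since \<open>T\<close> is strictly invertible, any \<open>g\<close> into
  \<open>TB\<close> is the suspension of \<open>far (Desusp S) g\<close>. The claim is then
  naturality of \<open>tp2\<close> followed by that of the inverse of \<open>tp1\<close>.\<close>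

lemma susp_shift_natural:
  assumes "f \<in> Arr C" "g \<in> Arr C" "Cod C f = A" "Cod C g = fob (Susp S) B" "B \<in> Obj C"
  shows "susp_shift A B \<cdot>\<^bsub>C\<^esub> (f \<star>\<^bsub>M\<^esub> g)
    = (far (Susp S) f \<star>\<^bsub>M\<^esub> far (Desusp S) g) \<cdot>\<^bsub>C\<^esub> susp_shift (Dom C f) (fob (Desusp S) (Dom C g))"
proof -
  let ?g = "far (Desusp S) g"
  have g: "Cod C ?g = B" "Dom C ?g = fob (Desusp S) (Dom C g)"
    using assms by simp_all
  have A: "A \<in> Obj C" using assms by auto
  have 1: "(far (Susp S) f \<star>\<^bsub>M\<^esub> ?g) \<cdot>\<^bsub>C\<^esub> inv_arrow C (tp1 (Dom C f) (Dom C ?g))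
    = inv_arrow C (tp1 A B) \<cdot>\<^bsub>C\<^esub> far (Susp S) (f \<star>\<^bsub>M\<^esub> ?g)"
    using tp_natural(1) [of f ?g] assms A by (intro Comp_inv_swap) simp_all
  have "susp_shift A B \<cdot>\<^bsub>C\<^esub> (f \<star>\<^bsub>M\<^esub> g)
    = inv_arrow C (tp1 A B) \<cdot>\<^bsub>C\<^esub> tp2 A B \<cdot>\<^bsub>C\<^esub> (f \<star>\<^bsub>M\<^esub> far (Susp S) ?g)"
    using assms A by (simp add: susp_shift_def)
  also have "\<dots> = inv_arrow C (tp1 A B) \<cdot>\<^bsub>C\<^esub> far (Susp S) (f \<star>\<^bsub>M\<^esub> ?g) \<cdot>\<^bsub>C\<^esub> tp2 (Dom C f) (Dom C ?g)"
    using tp_natural(2) [of f ?g] assms by simp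
  also have "\<dots> = (inv_arrow C (tp1 A B) \<cdot>\<^bsub>C\<^esub> far (Susp S) (f \<star>\<^bsub>M\<^esub> ?g)) \<cdot>\<^bsub>C\<^esub> tp2 (Dom C f) (Dom C ?g)"
    using assms A by simp
  also have "\<dots> = (far (Susp S) f \<star>\<^bsub>M\<^esub> ?g) \<cdot>\<^bsub>C\<^esub> susp_shift (Dom C f) (Dom C ?g)"
    unfolding 1 [symmetric] using assms A by (simp add: susp_shift_def)
  finally show ?thesis
    using g by simp
qed

text \<open>No sign appears, because the symmetry axiom of the suspended tensor product is used once for
  each of the two shifts and the anticommutation of \<open>tp\<^sub>1\<close> and \<open>tp\<^sub>2\<close> never is.\<close>

lemma susp_shift_symm:
  assumes "A \<in> Obj C" "B \<in> Obj C"
  shows "susp_shift B A \<cdot>\<^bsub>C\<^esub> symm M (fob (Susp S) A) B \<cdot>\<^bsub>C\<^esub> susp_shift A B = symm M A (fob (Susp S) B)"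
proof -
  have 1: "inv_arrow C (tp1 B A) \<cdot>\<^bsub>C\<^esub> tp2 B A \<cdot>\<^bsub>C\<^esub> symm M (fob (Susp S) A) B
    = inv_arrow C (tp1 B A) \<cdot>\<^bsub>C\<^esub> far (Susp S) (symm M A B) \<cdot>\<^bsub>C\<^esub> tp1 A B"
    using assms by (simp add: symm_susp)
  \<comment> \<open>Inserting a cancelling pair of symmetries makes \<open>symm_susp\<close>
    applicable with the roles of \<open>A\<close> and \<open>B\<close> exchanged; the two suspended
    symmetries then cancel.\<close>
  have "far (Susp S) (symm M A B) \<cdot>\<^bsub>C\<^esub> tp2 A B
    = far (Susp S) (symm M A B) \<cdot>\<^bsub>C\<^esub> (tp2 A B \<cdot>\<^bsub>C\<^esub> symm M (fob (Susp S) B) A) \<cdot>\<^bsub>C\<^esub> symm M A (fob (Susp S) B)"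
    using assms by (simp add: symm_symm)
  also have "\<dots> = far (Susp S) (symm M A B \<cdot>\<^bsub>C\<^esub> symm M B A) \<cdot>\<^bsub>C\<^esub> tp1 B A \<cdot>\<^bsub>C\<^esub> symm M A (fob (Susp S) B)"
    using assms by (simp flip: symm_susp)
  finally have 2: "far (Susp S) (symm M A B) \<cdot>\<^bsub>C\<^esub> tp2 A B = tp1 B A \<cdot>\<^bsub>C\<^esub> symm M A (fob (Susp S) B)"
    using assms by (simp add: symm_symm del: fst.susp.far_Comp_simp)
  have "susp_shift B A \<cdot>\<^bsub>C\<^esub> symm M (fob (Susp S) A) B \<cdot>\<^bsub>C\<^esub> susp_shift A B
    = (inv_arrow C (tp1 B A) \<cdot>\<^bsub>C\<^esub> tp2 B A \<cdot>\<^bsub>C\<^esub> symm M (fob (Susp S) A) B) \<cdot>\<^bsub>C\<^esub> susp_shift A B"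
    using assms by (simp add: susp_shift_def)
  also have "\<dots> = inv_arrow C (tp1 B A) \<cdot>\<^bsub>C\<^esub> far (Susp S) (symm M A B) \<cdot>\<^bsub>C\<^esub> tp2 A B"
    unfolding 1 using assms by (simp add: susp_shift_def)
  also have "\<dots> = symm M A (fob (Susp S) B)"
    unfolding 2 using assms by simp
  finally show ?thesis .
qed

abbreviation th :: "'o \<Rightarrow> 'o \<Rightarrow> 'a" where
  "th A K \<equiv> th1 C M S tp1 tp2 A K"

text \<open>Desuspension and transposition are both bijections on the arrows concerned. The only
  solution is thus the suspension of the transpose of the right side, and the description by
  \<open>THE\<close> in \<open>th1\<close> is legitimate.\<close>

lemma th1_ex1:
  assumes "A \<in> Obj C" "K \<in> Obj C"
  defines "H \<equiv> ihom_ob M (fob (Desusp S) A) K"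
  shows "\<exists>!h. h \<in> Hom C H (fob (Susp S) (ihom_ob M A K)) \<and>
    ev M A K \<cdot>\<^bsub>C\<^esub> (far (Desusp S) h \<star>\<^bsub>M\<^esub> Ident C A)
      = ev M (fob (Desusp S) A) K \<cdot>\<^bsub>C\<^esub> susp_shift (fob (Desusp S) H) (fob (Desusp S) A)"
    (is "\<exists>!h. ?P h")
proof (rule ex1I)
  let ?H' = "fob (Desusp S) H"
  show "?P (far (Susp S) (transpose A ?H' (ev M (fob (Desusp S) A) K \<cdot>\<^bsub>C\<^esub> susp_shift ?H' (fob (Desusp S) A))))"
    using assms by (simp add: Hom_def ev_transpose_Ident)
  fix h assume "?P h"
  then show "h = far (Susp S) (transpose A ?H' (ev M (fob (Desusp S) A) K \<cdot>\<^bsub>C\<^esub> susp_shift ?H' (fob (Desusp S) A)))"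
    using assms transpose_ev [of A K "far (Desusp S) h"] by (simp add: Hom_def)
qed

lemma th1_characterization:
  assumes "A \<in> Obj C" "K \<in> Obj C"
  defines "H \<equiv> ihom_ob M (fob (Desusp S) A) K"
  shows "th A K \<in> Hom C H (fob (Susp S) (ihom_ob M A K)) \<and>
    ev M A K \<cdot>\<^bsub>C\<^esub> (far (Desusp S) (th A K) \<star>\<^bsub>M\<^esub> Ident C A)
      = ev M (fob (Desusp S) A) K \<cdot>\<^bsub>C\<^esub> susp_shift (fob (Desusp S) H) (fob (Desusp S) A)"
  using theI' [OF th1_ex1 [OF assms(1,2)]] unfolding th1_def Let_def susp_shift_def H_def .

lemma th1_simps [simp]:
  assumes "A \<in> Obj C" "K \<in> Obj C"
  shows "th A K \<in> Arr C" "Dom C (th A K) = ihom_ob M (fob (Desusp S) A) K"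
    "Cod C (th A K) = fob (Susp S) (ihom_ob M A K)"
  using th1_characterization [OF assms] by (simp_all add: Hom_def)

text \<open>The defining equation of \<open>th1\<close> with arguments inserted. Moving them past
  the shift by \<open>susp_shift_natural\<close> suspends \<open>g\<close> and desuspends
  \<open>h\<close>.\<close>

lemma ev_th1:
  assumes "A \<in> Obj C" "K \<in> Obj C" "g \<in> Arr C"
    "Cod C g = fob (Desusp S) (ihom_ob M (fob (Desusp S) A) K)" "h \<in> Arr C" "Cod C h = A"
  shows "ev M A K \<cdot>\<^bsub>C\<^esub> ((far (Desusp S) (th A K) \<cdot>\<^bsub>C\<^esub> g) \<star>\<^bsub>M\<^esub> h)
    = ev M (fob (Desusp S) A) K \<cdot>\<^bsub>C\<^esub> (far (Susp S) g \<star>\<^bsub>M\<^esub> far (Desusp S) h)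
      \<cdot>\<^bsub>C\<^esub> susp_shift (Dom C g) (fob (Desusp S) (Dom C h))"
proof -
  let ?A' = "fob (Desusp S) A" and ?H' = "fob (Desusp S) (ihom_ob M (fob (Desusp S) A) K)"
  have "ev M A K \<cdot>\<^bsub>C\<^esub> ((far (Desusp S) (th A K) \<cdot>\<^bsub>C\<^esub> g) \<star>\<^bsub>M\<^esub> h)
    = (ev M A K \<cdot>\<^bsub>C\<^esub> (far (Desusp S) (th A K) \<star>\<^bsub>M\<^esub> Ident C A)) \<cdot>\<^bsub>C\<^esub> (g \<star>\<^bsub>M\<^esub> h)"
    using assms by auto
  also have "\<dots> = (ev M ?A' K \<cdot>\<^bsub>C\<^esub> susp_shift ?H' ?A') \<cdot>\<^bsub>C\<^esub> (g \<star>\<^bsub>M\<^esub> h)"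
    using th1_characterization [OF assms(1,2)] by simp
  also have "\<dots> = ev M ?A' K \<cdot>\<^bsub>C\<^esub> (far (Susp S) g \<star>\<^bsub>M\<^esub> far (Desusp S) h)
      \<cdot>\<^bsub>C\<^esub> susp_shift (Dom C g) (fob (Desusp S) (Dom C h))"
    using assms by (simp add: susp_shift_natural)
  finally show ?thesis .
qed

lemma ev_th1_Ident:
  assumes "A \<in> Obj C" "K \<in> Obj C" "h \<in> Arr C" "Cod C h = A"
  shows "ev M A K \<cdot>\<^bsub>C\<^esub> (far (Desusp S) (th A K) \<star>\<^bsub>M\<^esub> h)
    = ev M (fob (Desusp S) A) K \<cdot>\<^bsub>C\<^esub> (Ident C (ihom_ob M (fob (Desusp S) A) K) \<star>\<^bsub>M\<^esub> far (Desusp S) h)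
      \<cdot>\<^bsub>C\<^esub> susp_shift (fob (Desusp S) (ihom_ob M (fob (Desusp S) A) K)) (fob (Desusp S) (Dom C h))"
  using ev_th1 [of A K "Ident C (fob (Desusp S) (ihom_ob M (fob (Desusp S) A) K))" h] assms by simp

text \<open>Desuspended and evaluated, both sides become the shift, followed by
  \<open>T\<inverse>f\<close> in the second factor and by evaluation at \<open>T\<inverse>\<close>
  of the codomain of \<open>f\<close>.\<close>

lemma th1_natural:
  assumes "f \<in> Arr C" "K \<in> Obj C"
  shows "far (Susp S) (ihom_ar M f (Ident C K)) \<cdot>\<^bsub>C\<^esub> th (Cod C f) K
    = th (Dom C f) K \<cdot>\<^bsub>C\<^esub> ihom_ar M (far (Desusp S) f) (Ident C K)"
proof (rule fst.susp_cancel)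
  have "ihom_ar M f (Ident C K) \<cdot>\<^bsub>C\<^esub> far (Desusp S) (th (Cod C f) K)
    = far (Desusp S) (th (Dom C f) K) \<cdot>\<^bsub>C\<^esub> far (Desusp S) (ihom_ar M (far (Desusp S) f) (Ident C K))"
    by (rule ev_ext [of "Dom C f" K])
      (use assms in \<open>simp_all add: ev_ihom ev_th1 ev_th1_Ident Comp_rewrite [OF ev_ihom_Ident]\<close>)
  then show "far (Desusp S) (far (Susp S) (ihom_ar M f (Ident C K)) \<cdot>\<^bsub>C\<^esub> th (Cod C f) K)
    = far (Desusp S) (th (Dom C f) K \<cdot>\<^bsub>C\<^esub> ihom_ar M (far (Desusp S) f) (Ident C K))"
    using assms by simp
qed (simp_all add: assms)

lemma th1_iso:
  assumes "A \<in> Obj C" "K \<in> Obj C"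
  shows "iso_arrow C (th A K)"
proof -
  let ?A' = "fob (Desusp S) A" and ?H = "ihom_ob M A K" and ?H' = "ihom_ob M (fob (Desusp S) A) K"
  \<comment> \<open>The inverse \<open>T[A, K] \<rightarrow> [T\<inverse>A, K]\<close>: the
    transpose of \<open>T[A, K] \<otimes> T\<inverse>A \<rightarrow> [A, K] \<otimes> A
    \<rightarrow> K\<close>, whose first arrow is the inverse shift.\<close>
  define \<psi> where "\<psi> = transpose ?A' (fob (Susp S) ?H) (ev M A K \<cdot>\<^bsub>C\<^esub> inv_arrow C (susp_shift ?H ?A'))"
  have \<psi>: "\<psi> \<in> Arr C" "Dom C \<psi> = fob (Susp S) ?H" "Cod C \<psi> = ?H'"
    using assms by (simp_all add: \<psi>_def)
  have ev_\<psi>: "ev M ?A' K \<cdot>\<^bsub>C\<^esub> ((\<psi> \<cdot>\<^bsub>C\<^esub> g) \<star>\<^bsub>M\<^esub> Ident C ?A')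
    = ev M A K \<cdot>\<^bsub>C\<^esub> inv_arrow C (susp_shift ?H ?A') \<cdot>\<^bsub>C\<^esub> (g \<star>\<^bsub>M\<^esub> Ident C ?A')"
    if "g \<in> Arr C" "Cod C g = fob (Susp S) ?H" for g
    using that assms by (simp add: \<psi>_def ev_transpose)
  have ev_\<psi>': "ev M ?A' K \<cdot>\<^bsub>C\<^esub> (\<psi> \<star>\<^bsub>M\<^esub> Ident C ?A') = ev M A K \<cdot>\<^bsub>C\<^esub> inv_arrow C (susp_shift ?H ?A')"
    using ev_\<psi> [of "Ident C (fob (Susp S) ?H)"] assms \<psi> by simp
  have 1: "th A K \<cdot>\<^bsub>C\<^esub> \<psi> = Ident C (fob (Susp S) ?H)"
  proof (rule fst.susp_cancel)
    have "far (Desusp S) (th A K) \<cdot>\<^bsub>C\<^esub> far (Desusp S) \<psi> = Ident C ?H"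
      by (rule ev_ext [of A K]) (use assms \<psi> in \<open>simp_all add: ev_th1 Comp_rewrite [OF ev_\<psi>']\<close>)
    then show "far (Desusp S) (th A K \<cdot>\<^bsub>C\<^esub> \<psi>) = far (Desusp S) (Ident C (fob (Susp S) ?H))"
      using assms \<psi> by simp
  qed (use assms \<psi> in simp_all)
  \<comment> \<open>This composite already ends in an internal Hom, so it is evaluated without
    desuspending. Naturality of the inverse shift brings the desuspended \<open>th1\<close> next to
    \<open>ev\<close>, where the shift that it produces cancels.\<close>
  have 2: "\<psi> \<cdot>\<^bsub>C\<^esub> th A K = Ident C ?H'"
  proof (rule ev_ext [of ?A' K])
    let ?s = "inv_arrow C (susp_shift (fob (Desusp S) ?H') ?A')"
    have swap: "(far (Desusp S) (th A K) \<star>\<^bsub>M\<^esub> Ident C A) \<cdot>\<^bsub>C\<^esub> ?s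
      = inv_arrow C (susp_shift ?H ?A') \<cdot>\<^bsub>C\<^esub> (th A K \<star>\<^bsub>M\<^esub> Ident C ?A')"
      by (rule Comp_inv_swap) (use assms in \<open>simp_all add: susp_shift_natural\<close>)
    have "ev M ?A' K \<cdot>\<^bsub>C\<^esub> ((\<psi> \<cdot>\<^bsub>C\<^esub> th A K) \<star>\<^bsub>M\<^esub> Ident C ?A')
      = (ev M A K \<cdot>\<^bsub>C\<^esub> (far (Desusp S) (th A K) \<star>\<^bsub>M\<^esub> Ident C A)) \<cdot>\<^bsub>C\<^esub> ?s"
      using assms by (simp add: ev_\<psi> swap)
    also have "\<dots> = ev M ?A' K"
      using assms by (subst ev_th1_Ident) simp_all
    finally show "ev M ?A' K \<cdot>\<^bsub>C\<^esub> ((\<psi> \<cdot>\<^bsub>C\<^esub> th A K) \<star>\<^bsub>M\<^esub> Ident C ?A')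
      = ev M ?A' K \<cdot>\<^bsub>C\<^esub> (Ident C ?H' \<star>\<^bsub>M\<^esub> Ident C ?A')"
      using assms by simp
  qed (use assms \<psi> in simp_all)
  show ?thesis
    by (rule iso_arrowI [of _ \<psi>]) (use assms \<psi> 1 2 in simp_all)
qed

lemma dual_suspended:
  assumes "K \<in> Obj C"
  shows "suspended_functor (op_cat C) (op_susp S) C S (dual C M K) (\<lambda>A. th A K)"
  by (rule suspended_functorI)
    (simp_all add: assms fst.suspended_op fst.suspended_category_axioms dual_functor th1_iso th1_natural)

lemma dual_suspended_op:
  assumes "K \<in> Obj C"
  shows "suspended_functor C S (op_cat C) (op_susp S) (dual C M K)
    (op_susp_iso (op_susp S) S (\<lambda>A. th A K))"
  using suspended_functor.suspended_functor_op [OF dual_suspended [OF assms]] by simp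

text \<open>Each occurrence of \<open>th1\<close> evaluates to a shift, and the biduality between
  them contributes a symmetry. By \<open>susp_shift_symm\<close> this composite of shift, symmetry
  and shift is a single symmetry, the one in the evaluation of the biduality at
  \<open>A\<close>.\<close>

lemma bidual_susp:
  assumes "K \<in> Obj C" "A \<in> Obj C"
  shows "far (Susp S) (bidual C M K A) = th (ihom_ob M A K) K
    \<cdot>\<^bsub>C\<^esub> ihom_ar M (far (Desusp S) (th (fob (Susp S) A) K)) (Ident C K) \<cdot>\<^bsub>C\<^esub> bidual C M K (fob (Susp S) A)"
proof (rule fst.susp_cancel)
  let ?H = "ihom_ob M A K"
  let ?H' = "fob (Desusp S) ?H"
  let ?\<theta> = "far (Desusp S) (th (fob (Susp S) A) K)"
  let ?r = "ihom_ar M ?\<theta> (Ident C K) \<cdot>\<^bsub>C\<^esub> bidual C M K (fob (Susp S) A)"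
  have r: "?r \<in> Arr C" "Dom C ?r = fob (Susp S) A" "Cod C ?r = ihom_ob M ?H' K"
    using assms by simp_all
  have "bidual C M K A = far (Desusp S) (th ?H K) \<cdot>\<^bsub>C\<^esub> far (Desusp S) ?r"
  proof (rule ev_ext [of ?H K])
    \<comment> \<open>The desuspension of \<open>?r\<close> is kept as one arrow, so that the
      suspension introduced by \<open>ev_th1\<close> collapses directly to
      \<open>?r\<close>.\<close>
    have "ev M ?H K \<cdot>\<^bsub>C\<^esub> ((far (Desusp S) (th ?H K) \<cdot>\<^bsub>C\<^esub> far (Desusp S) ?r) \<star>\<^bsub>M\<^esub> Ident C ?H)
      = ev M ?H' K \<cdot>\<^bsub>C\<^esub> (?r \<star>\<^bsub>M\<^esub> Ident C ?H') \<cdot>\<^bsub>C\<^esub> susp_shift A ?H'"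
      by (subst ev_th1) (use assms r in \<open>simp_all del: fst.desusp.far_Comp_simp\<close>)
    also have "\<dots> = (ev M ?H' K \<cdot>\<^bsub>C\<^esub> (?r \<star>\<^bsub>M\<^esub> Ident C ?H')) \<cdot>\<^bsub>C\<^esub> susp_shift A ?H'"
      using assms by simp
    also have "\<dots> = (ev M (fob (Susp S) A) K \<cdot>\<^bsub>C\<^esub> (?\<theta> \<star>\<^bsub>M\<^esub> Ident C (fob (Susp S) A)))
        \<cdot>\<^bsub>C\<^esub> symm M (fob (Susp S) A) ?H' \<cdot>\<^bsub>C\<^esub> susp_shift A ?H'"
      using assms by (simp add: ev_ihom ev_bidual_Ident)
    also have "\<dots> = ev M A K \<cdot>\<^bsub>C\<^esub> susp_shift ?H' A \<cdot>\<^bsub>C\<^esub> symm M (fob (Susp S) A) ?H' \<cdot>\<^bsub>C\<^esub> susp_shift A ?H'"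
      by (subst ev_th1_Ident) (use assms in simp_all)
    also have "\<dots> = ev M ?H K \<cdot>\<^bsub>C\<^esub> (bidual C M K A \<star>\<^bsub>M\<^esub> Ident C ?H)"
      using assms by (simp add: susp_shift_symm ev_bidual_Ident)
    finally show "ev M ?H K \<cdot>\<^bsub>C\<^esub> (bidual C M K A \<star>\<^bsub>M\<^esub> Ident C ?H)
      = ev M ?H K \<cdot>\<^bsub>C\<^esub> ((far (Desusp S) (th ?H K) \<cdot>\<^bsub>C\<^esub> far (Desusp S) ?r) \<star>\<^bsub>M\<^esub> Ident C ?H)" ..
  qed (use assms r in simp_all)
  then show "far (Desusp S) (far (Susp S) (bidual C M K A)) = far (Desusp S) (th ?H K \<cdot>\<^bsub>C\<^esub> ?r)"
    using assms by simp
qed (use assms in simp_all)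

lemma dual_suspended_category_with_duality:
  assumes "K \<in> Obj C"
  shows "suspended_category_with_duality C S (dual C M K) (\<lambda>A. th A K) (bidual C M K)"
proof -
  note comp = suspended_functor_comp [OF dual_suspended_op dual_suspended, OF assms assms]
  have "suspended_functor_morphism C S C S id_functor (id_susp_iso C S) (dual C M K \<circ>\<^sub>F dual C M K)
      (comp_susp_iso C (dual C M K) (\<lambda>A. th A K) (dual C M K) (op_susp_iso (op_susp S) S (\<lambda>A. th A K)))
      (bidual C M K)"
    by (intro suspended_functor_morphism.intro suspended_functor_morphism_axioms.intro comp
        bidual_natural fst.suspended_functor_id)
      (simp_all add: assms id_susp_iso_def comp_susp_iso_def op_susp_iso_def bidual_susp)
  then show ?thesis
    by (intro suspended_category_with_duality.intro dual_category_with_duality dual_suspended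
        dual_suspended_op fst.suspended_category_axioms assms)
qed

end

section \<open>Compatibility of \<open>\<beta>\<close> with the suspensions\<close>

locale suspended_symmetric_monoidal_closed_functor =
  source: suspended_symmetric_monoidal_closed_category C M S tp1 tp2 +
  target: suspended_symmetric_monoidal_closed_category D N R tq1 tq2 +
  symmetric_monoidal_closed_functor C M D N F \<alpha> \<iota> +
  suspended_symmetric_monoidal_functor C M S tp1 tp2 D N R tq1 tq2 F \<phi> \<alpha> \<iota>
  for C :: "('o, 'a) cat" and M :: "('o, 'a) monoidal_closed" and S :: "('o, 'a) suspension"
    and tp1 :: "'o \<Rightarrow> 'o \<Rightarrow> 'a" and tp2 :: "'o \<Rightarrow> 'o \<Rightarrow> 'a"
    and D :: "('p, 'b) cat" and N :: "('p, 'b) monoidal_closed" and R :: "('p, 'b) suspension"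
    and tq1 :: "'p \<Rightarrow> 'p \<Rightarrow> 'b" and tq2 :: "'p \<Rightarrow> 'p \<Rightarrow> 'b"
    and F :: "('o, 'a, 'p, 'b) cfunctor" and \<phi> :: "'o \<Rightarrow> 'b"
    and \<alpha> :: "'o \<Rightarrow> 'o \<Rightarrow> 'b" and \<iota> :: "'b option"
begin

text \<open>The shift goes out through \<open>tp2\<close> and back through \<open>tp1\<close>.
  Accordingly \<open>commutes_b2\<close> treats the first half, and \<open>commutes_b1\<close>,
  solved for \<open>\<alpha>\<close> at \<open>TX\<close> and \<open>Y\<close>, treats the
  second.\<close>

lemma susp_shift_alpha:
  assumes "X \<in> Obj C" "Y \<in> Obj C"
  shows "far F (source.susp_shift X Y) \<cdot>\<^bsub>D\<^esub> \<alpha> X (fob (Susp S) Y)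
    = \<alpha> (fob (Susp S) X) Y \<cdot>\<^bsub>D\<^esub> (inv_arrow D (\<phi> X) \<star>\<^bsub>N\<^esub> Ident D (fob F Y))
      \<cdot>\<^bsub>D\<^esub> target.susp_shift (fob F X) (fob F Y) \<cdot>\<^bsub>D\<^esub> (Ident D (fob F X) \<star>\<^bsub>N\<^esub> \<phi> Y)"
proof -
  let ?\<alpha>1 = "\<alpha> (fob (Susp S) X) Y" and ?\<alpha>2 = "\<alpha> X (fob (Susp S) Y)" and ?\<alpha> = "far (Susp R) (\<alpha> X Y)"
  let ?tq1 = "tq1 (fob F X) (fob F Y)" and ?tq2 = "tq2 (fob F X) (fob F Y)"
  let ?\<phi>1 = "\<phi> X \<star>\<^bsub>N\<^esub> Ident D (fob F Y)" and ?\<phi>2 = "Ident D (fob F X) \<star>\<^bsub>N\<^esub> \<phi> Y"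
  let ?\<phi>i = "inv_arrow D (\<phi> X) \<star>\<^bsub>N\<^esub> Ident D (fob F Y)"
  let ?\<psi> = "inv_arrow D (\<phi> (X \<boxtimes>\<^bsub>M\<^esub> Y))" and ?t = "far F (inv_arrow C (tp1 X Y))"
  \<comment> \<open>The pair \<open>?\<phi>1\<close>, \<open>?\<phi>i\<close> is inserted to
    complete the left side of \<open>commutes_b1\<close>; on its right side \<open>?t\<close> and
    \<open>?\<psi>\<close> cancel \<open>F(tp1)\<close> and \<open>\<phi>\<close>.\<close>
  have "?t \<cdot>\<^bsub>D\<^esub> ?\<psi> \<cdot>\<^bsub>D\<^esub> ?\<alpha> \<cdot>\<^bsub>D\<^esub> ?tq1 = ?t \<cdot>\<^bsub>D\<^esub> ?\<psi> \<cdot>\<^bsub>D\<^esub> (?\<alpha> \<cdot>\<^bsub>D\<^esub> ?tq1 \<cdot>\<^bsub>D\<^esub> ?\<phi>1) \<cdot>\<^bsub>D\<^esub> ?\<phi>i"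
    using assms by simp
  also have "\<dots> = ?t \<cdot>\<^bsub>D\<^esub> ?\<psi> \<cdot>\<^bsub>D\<^esub> ((\<phi> (X \<boxtimes>\<^bsub>M\<^esub> Y) \<cdot>\<^bsub>D\<^esub> far F (tp1 X Y)) \<cdot>\<^bsub>D\<^esub> ?\<alpha>1) \<cdot>\<^bsub>D\<^esub> ?\<phi>i"
    by (simp only: commutes_b1 [OF assms])
  also have "\<dots> = far F (inv_arrow C (tp1 X Y) \<cdot>\<^bsub>C\<^esub> tp1 X Y) \<cdot>\<^bsub>D\<^esub> ?\<alpha>1 \<cdot>\<^bsub>D\<^esub> ?\<phi>i"
    using assms by (simp del: source.inv_simps(4,5))
  finally have 1: "?\<alpha>1 \<cdot>\<^bsub>D\<^esub> ?\<phi>i = ?t \<cdot>\<^bsub>D\<^esub> ?\<psi> \<cdot>\<^bsub>D\<^esub> ?\<alpha> \<cdot>\<^bsub>D\<^esub> ?tq1"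
    using assms by (simp del: far_Comp_simp)
  have "far F (source.susp_shift X Y) \<cdot>\<^bsub>D\<^esub> ?\<alpha>2
    = ?t \<cdot>\<^bsub>D\<^esub> ?\<psi> \<cdot>\<^bsub>D\<^esub> (\<phi> (X \<boxtimes>\<^bsub>M\<^esub> Y) \<cdot>\<^bsub>D\<^esub> far F (tp2 X Y)) \<cdot>\<^bsub>D\<^esub> ?\<alpha>2"
    using assms by (simp add: source.susp_shift_def)
  also have "\<dots> = ?t \<cdot>\<^bsub>D\<^esub> ?\<psi> \<cdot>\<^bsub>D\<^esub> ?\<alpha> \<cdot>\<^bsub>D\<^esub> ?tq2 \<cdot>\<^bsub>D\<^esub> ?\<phi>2"
    by (simp only: commutes_b2 [OF assms, symmetric])
  also have "\<dots> = (?t \<cdot>\<^bsub>D\<^esub> ?\<psi> \<cdot>\<^bsub>D\<^esub> ?\<alpha> \<cdot>\<^bsub>D\<^esub> ?tq1) \<cdot>\<^bsub>D\<^esub> target.susp_shift (fob F X) (fob F Y) \<cdot>\<^bsub>D\<^esub> ?\<phi>2"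
    using assms by (simp add: target.susp_shift_def)
  finally show ?thesis
    unfolding 1 [symmetric] using assms by simp
qed

lemma beta_susp:
  assumes "K \<in> Obj C" "A \<in> Obj C"
  shows "far (Susp R) (\<beta> A K) \<cdot>\<^bsub>D\<^esub> \<phi> (ihom_ob M A K) \<cdot>\<^bsub>D\<^esub> far F (source.th A K)
    = target.th (fob F A) (fob F K)
      \<cdot>\<^bsub>D\<^esub> ihom_ar N (far (Desusp R) (\<phi> (fob (Desusp S) A))) (Ident D (fob F K)) \<cdot>\<^bsub>D\<^esub> \<beta> (fob (Desusp S) A) K"
proof -
  let ?A' = "fob (Desusp S) A"
  let ?H = "ihom_ob M ?A' K"
  let ?H' = "fob (Desusp S) ?H"
  let ?\<theta> = "far (Desusp S) (source.th A K)"
  let ?\<phi>' = "far (Desusp R) (\<phi> ?A')"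
  let ?i = "inv_arrow D (\<phi> ?H')"
  let ?g = "ihom_ar N ?\<phi>' (Ident D (fob F K)) \<cdot>\<^bsub>D\<^esub> \<beta> ?A' K \<cdot>\<^bsub>D\<^esub> ?i"
  have g: "?g \<in> Arr D" "Dom D ?g = fob (Susp R) (fob F ?H')"
    "Cod D ?g = ihom_ob N (fob (Desusp R) (fob F A)) (fob F K)"
    using assms by simp_all
  \<comment> \<open>By naturality of \<open>\<phi>\<close>, the left side of the claim is
    \<open>T(\<beta> \<circ> F ?\<theta>)\<close> after \<open>\<phi>\<close> at \<open>?H'\<close>.
    The inverse \<open>?i\<close> inside \<open>?g\<close> strips off this last factor, which leaves
    an equation that can be desuspended and evaluated.\<close>
  have "far (Susp R) (\<beta> A K \<cdot>\<^bsub>D\<^esub> far F ?\<theta>) = target.th (fob F A) (fob F K) \<cdot>\<^bsub>D\<^esub> ?g"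
  proof (rule target.fst.susp_cancel)
    have "\<beta> A K \<cdot>\<^bsub>D\<^esub> far F ?\<theta> = far (Desusp R) (target.th (fob F A) (fob F K)) \<cdot>\<^bsub>D\<^esub> far (Desusp R) ?g"
    proof (rule target.ev_ext [of "fob F A" "fob F K"])
      have "ev N (fob F A) (fob F K) \<cdot>\<^bsub>D\<^esub> ((\<beta> A K \<cdot>\<^bsub>D\<^esub> far F ?\<theta>) \<star>\<^bsub>N\<^esub> Ident D (fob F A))
        = far F (ev M A K) \<cdot>\<^bsub>D\<^esub> \<alpha> (ihom_ob M A K) A \<cdot>\<^bsub>D\<^esub> (far F ?\<theta> \<star>\<^bsub>N\<^esub> far F (Ident C A))"
        using assms by (simp add: ev_beta)
      also have "\<dots> = far F (ev M A K \<cdot>\<^bsub>C\<^esub> (?\<theta> \<star>\<^bsub>M\<^esub> Ident C A)) \<cdot>\<^bsub>D\<^esub> \<alpha> ?H' A"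
        using assms by (simp add: alpha_natural del: far_Ident_simp)
      also have "\<dots> = far F (ev M ?A' K) \<cdot>\<^bsub>D\<^esub> far F (source.susp_shift ?H' ?A') \<cdot>\<^bsub>D\<^esub> \<alpha> ?H' (fob (Susp S) ?A')"
        by (subst source.ev_th1_Ident) (use assms in simp_all)
      \<comment> \<open>\<open>susp_shift_alpha\<close> replaces the source shift by the target
        shift between components of \<open>\<phi>\<close>; the one at \<open>?A'\<close> then passes
        the target shift and is desuspended to \<open>?\<phi>'\<close>.\<close>
      also have "\<dots> = far F (ev M ?A' K) \<cdot>\<^bsub>D\<^esub> \<alpha> ?H ?A' \<cdot>\<^bsub>D\<^esub> (?i \<star>\<^bsub>N\<^esub> ?\<phi>')
          \<cdot>\<^bsub>D\<^esub> target.susp_shift (fob F ?H') (fob (Desusp R) (fob F A))"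
        using assms by (subst susp_shift_alpha) (simp_all add: target.susp_shift_natural)
      \<comment> \<open>Read backwards: evaluating \<open>?g\<close> moves \<open>?\<phi>'\<close>
        to the second factor by extranaturality and turns \<open>\<beta>\<close> into
        \<open>F(ev) \<circ> \<alpha>\<close>.\<close>
      also have "\<dots> = (ev N (fob (Desusp R) (fob F A)) (fob F K)
          \<cdot>\<^bsub>D\<^esub> (?g \<star>\<^bsub>N\<^esub> Ident D (fob (Desusp R) (fob F A))))
          \<cdot>\<^bsub>D\<^esub> target.susp_shift (fob F ?H') (fob (Desusp R) (fob F A))"
        using assms by (simp add: target.ev_ihom ev_beta)
      also have "\<dots> = ev N (fob F A) (fob F K) \<cdot>\<^bsub>D\<^esub>
          ((far (Desusp R) (target.th (fob F A) (fob F K)) \<cdot>\<^bsub>D\<^esub> far (Desusp R) ?g) \<star>\<^bsub>N\<^esub> Ident D (fob F A))"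
        by (subst target.ev_th1) (use assms g in \<open>simp_all del: target.fst.desusp.far_Comp_simp\<close>)
      finally show "ev N (fob F A) (fob F K) \<cdot>\<^bsub>D\<^esub> ((\<beta> A K \<cdot>\<^bsub>D\<^esub> far F ?\<theta>) \<star>\<^bsub>N\<^esub> Ident D (fob F A))
        = ev N (fob F A) (fob F K) \<cdot>\<^bsub>D\<^esub>
          ((far (Desusp R) (target.th (fob F A) (fob F K)) \<cdot>\<^bsub>D\<^esub> far (Desusp R) ?g) \<star>\<^bsub>N\<^esub> Ident D (fob F A))" .
    qed (use assms g in simp_all)
    then show "far (Desusp R) (far (Susp R) (\<beta> A K \<cdot>\<^bsub>D\<^esub> far F ?\<theta>))
      = far (Desusp R) (target.th (fob F A) (fob F K) \<cdot>\<^bsub>D\<^esub> ?g)"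
      using assms by simp
  qed (use assms in simp_all)
  from arg_cong [OF this, of "\<lambda>h. h \<cdot>\<^bsub>D\<^esub> \<phi> ?H'"] show ?thesis
    using assms susp_iso_natural [of ?\<theta>] by simp
qed

lemma beta_suspended_duality_preserving:
  assumes "K \<in> Obj C"
  shows "suspended_duality_preserving_functor
    C S (dual C M K) (\<lambda>A. source.th A K) (bidual C M K)
    D R (dual D N (fob F K)) (\<lambda>A. target.th A (fob F K)) (bidual D N (fob F K)) F \<phi> (\<lambda>A. \<beta> A K)"
proof -
  interpret beta: duality_preserving_functor C "dual C M K" "bidual C M K"
      D "dual D N (fob F K)" "bidual D N (fob F K)" F "\<lambda>A. \<beta> A K"
    by (rule beta_duality_preserving) fact
  have FK: "fob F K \<in> Obj D"
    using assms by simp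
  have "suspended_functor_morphism (op_cat C) (op_susp S) D R
    (F \<circ>\<^sub>F dual C M K) (comp_susp_iso D F \<phi> (dual C M K) (\<lambda>A. source.th A K))
    (dual D N (fob F K) \<circ>\<^sub>F F)
    (comp_susp_iso D (dual D N (fob F K)) (\<lambda>A. target.th A (fob F K)) F (op_susp_iso S R \<phi>)) (\<lambda>A. \<beta> A K)"
    by (intro suspended_functor_morphism.intro suspended_functor_morphism_axioms.intro
        suspended_functor_comp [OF source.dual_suspended suspended_functor_axioms]
        suspended_functor_comp [OF suspended_functor_op target.dual_suspended]
        beta.natural_transformation_axioms assms FK)
      (simp add: assms comp_susp_iso_def op_susp_iso_def beta_susp)
  then show ?thesis
    by (intro suspended_duality_preserving_functor.intro source.dual_suspended_category_with_duality
        target.dual_suspended_category_with_duality beta.duality_preserving_functor_axioms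
        suspended_functor_axioms assms FK)
qed

end

section \<open>Exactness of the duality in both directions\<close>

context triangulated_symmetric_monoidal_closed_category
begin

lemma dual_triangulated_category_with_duality:
  assumes "K \<in> Obj C"
  shows "triangulated_category_with_duality C S \<Delta> (dual C M K) (\<lambda>A. th A K) (bidual C M K)"
proof -
  interpret op: exact_functor "op_cat C" "op_susp S" "op_triangles S \<Delta>" C S \<Delta> "dual C M K" "\<lambda>A. th A K"
    using ihom_exact_fst [OF assms] unfolding dual_def .
  have "exact_functor C S \<Delta> (op_cat C) (op_susp S) (op_triangles S \<Delta>) (dual C M K)
      (op_susp_iso (op_susp S) S (\<lambda>A. th A K))"
  proof (intro exact_functor.intro exact_functor_axioms.intro dual_suspended_op assms)
    fix u v w assume uvw: "(u, v, w) \<in> \<Delta>"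
    let ?D = "\<lambda>f. ihom_ar M f (Ident C K)"
    have w: "u \<in> Arr C" "w \<in> Arr C" "Cod C w = fob (Susp S) (Dom C u)" and v: "Cod C v = Dom C w"
      using exact_is_triangle [OF uvw] unfolding is_triangle_def Hom_def by blast+
    have "(v, u, far (Desusp S) w) \<in> op_triangles S \<Delta>"
      using uvw by (auto simp: op_triangles_def)
    from op.exact [OF this]
    have "(?D v, ?D u, th (Dom C w) K \<cdot>\<^bsub>C\<^esub> ?D (far (Desusp S) w)) \<in> \<Delta>"
      using v by simp
    \<comment> \<open>\<open>th1_natural\<close> at \<open>w\<close> rewrites the third arrow so
      that its desuspension becomes \<open>?D w\<close> preceded by the desuspended
      \<open>th1\<close>. This is the third arrow that exactness into the opposite category
      requires.\<close>
    then have "(?D v, ?D u, far (Susp S) (?D w) \<cdot>\<^bsub>C\<^esub> th (Cod C w) K) \<in> \<Delta>"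
      using assms w th1_natural [of w K] by simp
    then have "(?D u, ?D v, far (Desusp S) (far (Susp S) (?D w) \<cdot>\<^bsub>C\<^esub> th (Cod C w) K)) \<in> op_triangles S \<Delta>"
      by (auto simp: op_triangles_def)
    then show "(far (dual C M K) u, far (dual C M K) v,
      op_susp_iso (op_susp S) S (\<lambda>A. th A K) (Dom C u) \<cdot>\<^bsub>op_cat C\<^esub> far (dual C M K) w) \<in> op_triangles S \<Delta>"
      using assms w by (simp add: op_susp_iso_def)
  qed
  then show ?thesis
    by (intro triangulated_category_with_duality.intro dual_suspended_category_with_duality
        triangulated_category_axioms op.exact_functor_axioms assms)
qed

end

section \<open>The plain, suspended and triangulated cases together\<close>

theorem theorem4p1p2:
  fixes C1 :: "('o1, 'a1) cat" and M1 :: "('o1, 'a1) monoidal_closed"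
    and S1 :: "('o1, 'a1) suspension" and tp1 tp2 :: "'o1 \<Rightarrow> 'o1 \<Rightarrow> 'a1"
    and \<Delta>1 :: "('a1 \<times> 'a1 \<times> 'a1) set"
    and C2 :: "('o2, 'a2) cat" and M2 :: "('o2, 'a2) monoidal_closed"
    and S2 :: "('o2, 'a2) suspension" and tq1 tq2 :: "'o2 \<Rightarrow> 'o2 \<Rightarrow> 'a2"
    and \<Delta>2 :: "('a2 \<times> 'a2 \<times> 'a2) set"
    and F :: "('o1, 'a1, 'o2, 'a2) cfunctor" and \<alpha> :: "'o1 \<Rightarrow> 'o1 \<Rightarrow> 'a2"
    and \<iota> :: "'a2 option" and \<phi> :: "'o1 \<Rightarrow> 'a2" and K :: 'o1
  assumes "symmetric_monoidal_closed_category C1 M1"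
    and "symmetric_monoidal_closed_category C2 M2"
    and "symmetric_monoidal_functor C1 M1 C2 M2 F \<alpha> \<iota>"
    and "K \<in> Obj C1"
  shows "duality_preserving_functor
           C1 (dual C1 M1 K) (bidual C1 M1 K)
           C2 (dual C2 M2 (fob F K)) (bidual C2 M2 (fob F K))
           F (\<lambda>A. beta M1 C2 M2 F \<alpha> A K)
    \<and> (suspended_symmetric_monoidal_closed_category C1 M1 S1 tp1 tp2 \<and>
       suspended_symmetric_monoidal_closed_category C2 M2 S2 tq1 tq2 \<and>
       suspended_symmetric_monoidal_functor C1 M1 S1 tp1 tp2 C2 M2 S2 tq1 tq2 F \<phi> \<alpha> \<iota> \<longrightarrow>
       suspended_duality_preserving_functor
         C1 S1 (dual C1 M1 K) (\<lambda>A. th1 C1 M1 S1 tp1 tp2 A K) (bidual C1 M1 K)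
         C2 S2 (dual C2 M2 (fob F K)) (\<lambda>A. th1 C2 M2 S2 tq1 tq2 A (fob F K))
           (bidual C2 M2 (fob F K))
         F \<phi> (\<lambda>A. beta M1 C2 M2 F \<alpha> A K))
    \<and> (triangulated_symmetric_monoidal_closed_category C1 M1 S1 tp1 tp2 \<Delta>1 \<and>
       triangulated_symmetric_monoidal_closed_category C2 M2 S2 tq1 tq2 \<Delta>2 \<and>
       triangulated_symmetric_monoidal_functor C1 M1 S1 tp1 tp2 \<Delta>1 C2 M2 S2 tq1 tq2 \<Delta>2 F \<phi> \<alpha> \<iota> \<longrightarrow>
       triangulated_duality_preserving_functor
         C1 S1 \<Delta>1 (dual C1 M1 K) (\<lambda>A. th1 C1 M1 S1 tp1 tp2 A K) (bidual C1 M1 K)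
         C2 S2 \<Delta>2 (dual C2 M2 (fob F K)) (\<lambda>A. th1 C2 M2 S2 tq1 tq2 A (fob F K))
           (bidual C2 M2 (fob F K))
         F \<phi> (\<lambda>A. beta M1 C2 M2 F \<alpha> A K))"
proof -
  interpret symmetric_monoidal_closed_functor C1 M1 C2 M2 F \<alpha> \<iota>
    by (intro symmetric_monoidal_closed_functor.intro assms(1-3))
  have suspended: "suspended_duality_preserving_functor
         C1 S1 (dual C1 M1 K) (\<lambda>A. th1 C1 M1 S1 tp1 tp2 A K) (bidual C1 M1 K)
         C2 S2 (dual C2 M2 (fob F K)) (\<lambda>A. th1 C2 M2 S2 tq1 tq2 A (fob F K))
           (bidual C2 M2 (fob F K))
         F \<phi> (\<lambda>A. beta M1 C2 M2 F \<alpha> A K)"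
    if "suspended_symmetric_monoidal_closed_category C1 M1 S1 tp1 tp2"
      "suspended_symmetric_monoidal_closed_category C2 M2 S2 tq1 tq2"
      "suspended_symmetric_monoidal_functor C1 M1 S1 tp1 tp2 C2 M2 S2 tq1 tq2 F \<phi> \<alpha> \<iota>"
    by (rule suspended_symmetric_monoidal_closed_functor.beta_suspended_duality_preserving
        [OF suspended_symmetric_monoidal_closed_functor.intro
          [OF that(1,2) symmetric_monoidal_closed_functor_axioms that(3)] assms(4)])
  have triangulated: "triangulated_duality_preserving_functor
         C1 S1 \<Delta>1 (dual C1 M1 K) (\<lambda>A. th1 C1 M1 S1 tp1 tp2 A K) (bidual C1 M1 K)
         C2 S2 \<Delta>2 (dual C2 M2 (fob F K)) (\<lambda>A. th1 C2 M2 S2 tq1 tq2 A (fob F K))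
           (bidual C2 M2 (fob F K))
         F \<phi> (\<lambda>A. beta M1 C2 M2 F \<alpha> A K)"
    if C1: "triangulated_symmetric_monoidal_closed_category C1 M1 S1 tp1 tp2 \<Delta>1"
      and C2: "triangulated_symmetric_monoidal_closed_category C2 M2 S2 tq1 tq2 \<Delta>2"
      and F: "triangulated_symmetric_monoidal_functor C1 M1 S1 tp1 tp2 \<Delta>1 C2 M2 S2 tq1 tq2 \<Delta>2 F \<phi> \<alpha> \<iota>"
  proof -
    interpret C1: triangulated_symmetric_monoidal_closed_category C1 M1 S1 tp1 tp2 \<Delta>1 by (fact C1)
    interpret C2: triangulated_symmetric_monoidal_closed_category C2 M2 S2 tq1 tq2 \<Delta>2 by (fact C2)
    interpret F: triangulated_symmetric_monoidal_functor
      C1 M1 S1 tp1 tp2 \<Delta>1 C2 M2 S2 tq1 tq2 \<Delta>2 F \<phi> \<alpha> \<iota> by (fact F)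
    \<comment> \<open>The triangulated hypotheses contain the suspended ones, so only exactness is
      new: that of the dualities comes from the preceding lemma, that of \<open>F\<close> is
      assumed.\<close>
    show ?thesis
      by (intro triangulated_duality_preserving_functor.intro
          C1.dual_triangulated_category_with_duality C2.dual_triangulated_category_with_duality
          suspended C1.suspended_symmetric_monoidal_closed_category_axioms
          C2.suspended_symmetric_monoidal_closed_category_axioms
          F.suspended_symmetric_monoidal_functor_axioms F.exact_functor_axioms assms(4) fob_Obj)
  qed
  show ?thesis
    using beta_duality_preserving [OF assms(4)] suspended triangulated by blast
qed

end
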